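(* Consider the constrained online convex optimization problem on the probability simplex described in the context, and suppose that the boundedness/smoothness assumptions and Slater's condition with constant $\varsigma>0$ hold. Set $$\eta=[V_\infty(T)+L_f^2+1]^{-1/2},\quad \gamma=[V_\infty(T)+L_f^2+1]^{1/4},\quad \nu=1/T,$$ $$\alpha_t=\max\big\{3(\eta L_f^2+\gamma^2L_gG)+2/\eta+3\xi_t,\ \alpha_{t-1}\big\}\quad\text{with }\alpha_0=0,$$ where $\xi_t:=\gamma L_g\|\mathbf Q(t)\|_1+\gamma^2(L_gG+H^2)$. Then, for $T>2$ and $d\ge1$, the online primal-dual mirror-prox algorithm on the probability simplex described in the context ensures the following regret: $$\mathrm{Regret}(T)\le\tilde{\mathcal O}\big(\sqrt{V_\infty(T)}\vee L_f\big),$$ where $\tilde{\mathcal O}$ hides constants $\mathrm{poly}(H,F,G,L_g,K,1/\varsigma)$ and the logarithmic factor $\log^2(Td)$.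
   Context: Notation. $\Delta=\{\mathbf x\in\mathbb R^d:\|\mathbf x\|_1=1,\ \mathbf x_i\ge0\ \forall i\in[d]\}$ is the probability simplex; $\boldsymbol 1\in\mathbb R^d$ is the all-ones vector; $D_{\mathrm{KL}}(\mathbf x,\mathbf y)=\sum_{i=1}^d\mathbf x_i\log(\mathbf x_i/\mathbf y_i)$ is the Kullback-Leibler divergence, for $\mathbf x\in\Delta$ and $\mathbf y$ in the relative interior of $\Delta$; $[n]=\{1,\dots,n\}$; $a\vee b=\max\{a,b\}$; $\mathrm{poly}(\cdots)$ denotes a polynomial term composed of the variables inside the parentheses. The norm is $\|\cdot\|_1$, with dual norm $\|\cdot\|_\infty$. Problem. The losses $f^t:\Delta\to\mathbb R$ are convex and differentiable; $f^t$ is observed after the decision $\mathbf x_t$ is generated. The constraint functions $g_k$, $k\in[K]$, are convex and differentiable; $\mathcal X=\{\mathbf x\in\Delta:g_k(\mathbf x)\le0,\ \forall k\in[K]\}$. Over $T$ rounds, $$\mathrm{Regret}(T)=\sum_{t=1}^Tf^t(\mathbf x_t)-\sum_{t=1}^Tf^t(\mathbf x^* ),\quad \mathbf x^*\in\arg\min_{\mathbf x\in\mathcal X}\sum_{t=1}^Tf^t(\mathbf x),$$ $$V_\infty(T)=\sum_{t=1}^T\max_{\mathbf x\in\Delta}\|\nabla f^t(\mathbf x)-\nabla f^{t-1}(\mathbf x)\|_\infty^2.$$ Boundedness/smoothness assumptions. For all $\mathbf x,\mathbf y\in\Delta$, $t\ge0$, $k\in[K]$: $\|\nabla f^t(\mathbf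 x)\|_\infty\le F$; $\|\nabla f^t(\mathbf x)-\nabla f^t(\mathbf y)\|_\infty\le L_f\|\mathbf x-\mathbf y\|_1$; $\sum_{k=1}^K|g_k(\mathbf x)|\le G$; $|g_k(\mathbf x)-g_k(\mathbf y)|\le H_k\|\mathbf x-\mathbf y\|_1$, with $H:=\sum_{k=1}^KH_k$; $\|\nabla g_k(\mathbf x)-\nabla g_k(\mathbf y)\|_\infty\le L_g\|\mathbf x-\mathbf y\|_1$. Slater's condition. There exist a constant $\varsigma>0$ and a point $\breve{\mathbf x}\in\Delta$ such that $g_k(\breve{\mathbf x})\le-\varsigma$ for all $k\in[K]$. Online primal-dual mirror-prox algorithm on the probability simplex (parameters $\gamma>0$, $\nu\in(0,1]$, $\alpha_t$). Initialize $\mathbf x_0=\mathbf x_1=\tilde{\mathbf x}_1=\boldsymbol 1/d$ and $Q_k(0)=0$, $k\in[K]$. For $t=1,\dots,T$: (1) mix the iterates: $\tilde{\mathbf y}_t=(1-\nu)\tilde{\mathbf x}_t+\frac{\nu}{d}\boldsymbol 1$; (2) update the dual iterate $Q_k(t)=\max\{-\gamma g_k(\mathbf x_{t-1}),\ Q_k(t-1)+\gamma g_k(\mathbf x_{t-1})\}$ for $k\in[K]$, and write $\mathbf Q(t)=[Q_1(t),\dots,Q_K(t)]^\top$; (3) update the primal iterate $\mathbf x_t=\arg\min_{\mathbf x\in\Delta}\langle\nabla f^{t-1}(\mathbf x_{t-1}),\mathbf x\rangle+\sum_{k=1}^K[Q_k(t)+\gamma g_k(\mathbf x_{t-1})]\langle\gamma\nabla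 g_k(\mathbf x_{t-1}),\mathbf x\rangle+\alpha_tD_{\mathrm{KL}}(\mathbf x,\tilde{\mathbf y}_t)$; (4) play $\mathbf x_t$, suffer loss $f^t(\mathbf x_t)$ and compute $\nabla f^t(\mathbf x_t)$; (5) update the intermediate iterate $\tilde{\mathbf x}_{t+1}=\arg\min_{\mathbf x\in\Delta}\langle\nabla f^t(\mathbf x_t),\mathbf x\rangle+\sum_{k=1}^K[Q_k(t)+\gamma g_k(\mathbf x_{t-1})]\langle\gamma\nabla g_k(\mathbf x_{t-1}),\mathbf x\rangle+\alpha_tD_{\mathrm{KL}}(\mathbf x,\tilde{\mathbf y}_t)$.
   Formalization: The bound is proved with max{1, √V_∞(T), L_f} in place of √V_∞(T) ∨ L_f; without the 1 it fails, e.g. for d=2, inactive constant constraints and f^t(x)=εx_1 for all t, where V_∞(T)=L_f=0 but the regret is positive. *)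

theory Defs
  imports "HOL-Analysis.Analysis" "HOL-Analysis.Finite_Function_Topology"
begin

(* The constants of the final bound must not depend on the dimension d, so d has to be a number
   that can be quantified inside the statement.  R^d is therefore the subspace of the normed space
   nat \<Rightarrow>\<^sub>0 real of finitely supported sequences whose elements vanish outside [d] = {1..d}. *)

type_synonym rvec = "nat \<Rightarrow>\<^sub>0 real"

definition Rd :: "nat \<Rightarrow> rvec set" where
  "Rd d = {x. Poly_Mapping.keys x \<subseteq> {1..d}}"

(* The library norm on this space is the 1-norm. *)
lemma norm_Rd:
  assumes "x \<in> Rd d"
  shows "norm x = (\<Sum>i = 1..d. \<bar>Poly_Mapping.lookup x i\<bar>)"
  using assms
  by (auto simp: Rd_def norm_poly_mapping_def dist_poly_mapping_def in_keys_iff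
      intro!: sum.mono_neutral_cong_left)

definition dot :: "nat \<Rightarrow> rvec \<Rightarrow> rvec \<Rightarrow> real" where
  "dot d x y = (\<Sum>i = 1..d. Poly_Mapping.lookup x i * Poly_Mapping.lookup y i)"

definition norm_inf :: "nat \<Rightarrow> rvec \<Rightarrow> real" where
  "norm_inf d x = (MAX i\<in>{1..d}. \<bar>Poly_Mapping.lookup x i\<bar>)"

definition ones :: "nat \<Rightarrow> rvec" where
  "ones d = (\<Sum>i = 1..d. Poly_Mapping.single i 1)"

definition prob_simplex :: "nat \<Rightarrow> rvec set" where
  "prob_simplex d = {x \<in> Rd d. norm x = 1 \<and> (\<forall>i\<in>{1..d}. 0 \<le> Poly_Mapping.lookup x i)}"

(* Summands with x_i = 0 vanish, i.e. 0 log 0 = 0. *)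
definition KL :: "nat \<Rightarrow> rvec \<Rightarrow> rvec \<Rightarrow> real" where
  "KL d x y = (\<Sum>i = 1..d. Poly_Mapping.lookup x i *
      ln (Poly_Mapping.lookup x i / Poly_Mapping.lookup y i))"

(* v is a gradient at x of a function given on the simplex only.  The derivative is taken within
   the simplex, which determines v only up to the part normal to it; statements about gradient
   fields are meant for every choice (in particular for the restriction of the gradient of a
   function that is differentiable on a neighbourhood). *)
definition is_gradient :: "nat \<Rightarrow> (rvec \<Rightarrow> real) \<Rightarrow> rvec \<Rightarrow> rvec \<Rightarrow> bool" where
  "is_gradient d f x v \<longleftrightarrow>
     v \<in> Rd d \<and> (f has_derivative (\<lambda>h. dot d v h)) (at x within prob_simplex d)"

definition convex_diff :: "nat \<Rightarrow> (rvec \<Rightarrow> real) \<Rightarrow> (rvec \<Rightarrow> rvec) \<Rightarrow> bool" where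
  "convex_diff d f df \<longleftrightarrow>
     convex_on (prob_simplex d) f \<and> (\<forall>x\<in>prob_simplex d. is_gradient d f x (df x))"

definition feasible :: "nat \<Rightarrow> nat \<Rightarrow> (nat \<Rightarrow> rvec \<Rightarrow> real) \<Rightarrow> rvec set" where
  "feasible d K g = {x \<in> prob_simplex d. \<forall>k\<in>{1..K}. g k x \<le> 0}"

definition regret :: "nat \<Rightarrow> (nat \<Rightarrow> rvec \<Rightarrow> real) \<Rightarrow> (nat \<Rightarrow> rvec) \<Rightarrow> rvec \<Rightarrow> real" where
  "regret T f x xstar = (\<Sum>t = 1..T. f t (x t)) - (\<Sum>t = 1..T. f t xstar)"

(* The supremum is a maximum when the gradients are continuous on the (compact) simplex. *)
definition V_inf :: "nat \<Rightarrow> nat \<Rightarrow> (nat \<Rightarrow> rvec \<Rightarrow> rvec) \<Rightarrow> real" where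
  "V_inf d T df =
     (\<Sum>t = 1..T. SUP x\<in>prob_simplex d. (norm_inf d (df t x - df (t - 1) x))\<^sup>2)"

definition bounded_smooth ::
  "nat \<Rightarrow> nat \<Rightarrow> (nat \<Rightarrow> rvec \<Rightarrow> rvec) \<Rightarrow> (nat \<Rightarrow> rvec \<Rightarrow> real) \<Rightarrow> (nat \<Rightarrow> rvec \<Rightarrow> rvec) \<Rightarrow>
   real \<Rightarrow> real \<Rightarrow> real \<Rightarrow> (nat \<Rightarrow> real) \<Rightarrow> real \<Rightarrow> bool" where
  "bounded_smooth d K df g dg F Lf G Hk Lg \<longleftrightarrow>
     0 \<le> F \<and> 0 \<le> Lf \<and> 0 \<le> G \<and> (\<forall>k\<in>{1..K}. 0 \<le> Hk k) \<and> 0 \<le> Lg \<and>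
     (\<forall>t. \<forall>x\<in>prob_simplex d. norm_inf d (df t x) \<le> F) \<and>
     (\<forall>t. \<forall>x\<in>prob_simplex d. \<forall>y\<in>prob_simplex d. norm_inf d (df t x - df t y) \<le> Lf * norm (x - y)) \<and>
     (\<forall>x\<in>prob_simplex d. (\<Sum>k = 1..K. \<bar>g k x\<bar>) \<le> G) \<and>
     (\<forall>k\<in>{1..K}. \<forall>x\<in>prob_simplex d. \<forall>y\<in>prob_simplex d. \<bar>g k x - g k y\<bar> \<le> Hk k * norm (x - y)) \<and>
     (\<forall>k\<in>{1..K}. \<forall>x\<in>prob_simplex d. \<forall>y\<in>prob_simplex d.
        norm_inf d (dg k x - dg k y) \<le> Lg * norm (x - y))"

definition slater :: "nat \<Rightarrow> nat \<Rightarrow> (nat \<Rightarrow> rvec \<Rightarrow> real) \<Rightarrow> real \<Rightarrow> bool" where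
  "slater d K g \<sigma> \<longleftrightarrow> 0 < \<sigma> \<and> (\<exists>x\<in>prob_simplex d. \<forall>k\<in>{1..K}. g k x \<le> - \<sigma>)"

(* Common objective of the two prox steps: v is the loss gradient, q the vector Q(t), xp the
   previous decision x_{t-1}, a the step parameter and y the prox centre. *)
definition prox_objective ::
  "nat \<Rightarrow> nat \<Rightarrow> (nat \<Rightarrow> rvec \<Rightarrow> real) \<Rightarrow> (nat \<Rightarrow> rvec \<Rightarrow> rvec) \<Rightarrow> real \<Rightarrow>
   rvec \<Rightarrow> (nat \<Rightarrow> real) \<Rightarrow> rvec \<Rightarrow> real \<Rightarrow> rvec \<Rightarrow> rvec \<Rightarrow> real" where
  "prox_objective d K g dg \<gamma> v q xp a y x =
     dot d v x
     + (\<Sum>k = 1..K. (q k + \<gamma> * g k xp) * dot d (\<gamma> *\<^sub>R dg k xp) x)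
     + a * KL d x y"

(* The sequences x (decisions), xt (intermediate iterates) and Q (with Q k t for Q_k(t)) form a
   run over T rounds.  Step 3 is executed from round 1 on and overwrites the initial value of x_1,
   which is therefore not recorded; df 0 is the gradient of f^0. *)
definition mirror_prox_run ::
  "nat \<Rightarrow> nat \<Rightarrow> nat \<Rightarrow> (nat \<Rightarrow> rvec \<Rightarrow> rvec) \<Rightarrow> (nat \<Rightarrow> rvec \<Rightarrow> real) \<Rightarrow> (nat \<Rightarrow> rvec \<Rightarrow> rvec) \<Rightarrow>
   real \<Rightarrow> real \<Rightarrow> (nat \<Rightarrow> real) \<Rightarrow> (nat \<Rightarrow> rvec) \<Rightarrow> (nat \<Rightarrow> rvec) \<Rightarrow> (nat \<Rightarrow> nat \<Rightarrow> real) \<Rightarrow> bool" where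
  "mirror_prox_run d K T df g dg \<gamma> \<nu> \<alpha> x xt Q \<longleftrightarrow>
     x 0 = (1 / real d) *\<^sub>R ones d \<and> xt 1 = (1 / real d) *\<^sub>R ones d \<and>
     (\<forall>k\<in>{1..K}. Q k 0 = 0) \<and>
     (\<forall>t\<in>{1..T}.
        let y = (1 - \<nu>) *\<^sub>R xt t + (\<nu> / real d) *\<^sub>R ones d;
            xp = x (t - 1);
            obj = (\<lambda>v. prox_objective d K g dg \<gamma> v (\<lambda>k. Q k t) xp (\<alpha> t) y)
        in (\<forall>k\<in>{1..K}. Q k t = max (- \<gamma> * g k xp) (Q k (t - 1) + \<gamma> * g k xp)) \<and>
           is_arg_min (obj (df (t - 1) xp)) (\<lambda>z. z \<in> prob_simplex d) (x t) \<and>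
           is_arg_min (obj (df t (x t))) (\<lambda>z. z \<in> prob_simplex d) (xt (t + 1)))"

(* alpha_t for t = 0, ..., T, with H the sum of the H_k. *)
definition step_params ::
  "nat \<Rightarrow> nat \<Rightarrow> real \<Rightarrow> real \<Rightarrow> real \<Rightarrow> real \<Rightarrow> real \<Rightarrow> real \<Rightarrow> (nat \<Rightarrow> nat \<Rightarrow> real) \<Rightarrow> (nat \<Rightarrow> real) \<Rightarrow> bool"
  where
  "step_params K T \<eta> \<gamma> Lf G H Lg Q \<alpha> \<longleftrightarrow>
     \<alpha> 0 = 0 \<and>
     (\<forall>t\<in>{1..T}.
        let \<xi> = \<gamma> * Lg * (\<Sum>k = 1..K. \<bar>Q k t\<bar>) + \<gamma>\<^sup>2 * (Lg * G + H\<^sup>2)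
        in \<alpha> t = max (3 * (\<eta> * Lf\<^sup>2 + \<gamma>\<^sup>2 * Lg * G) + 2 / \<eta> + 3 * \<xi>) (\<alpha> (t - 1)))"

end

theory Submission
  imports Defs
begin

text \<open>
  The idea is to follow a potential that combines the squared norm of the dual iterates with the
  unused part of the divergence terms. In one round (\<open>one_round\<close>), the linearised loss against a
  comparison point plus the increase of the potential is at most the weighted constraint values at
  the comparison point, plus \<open>\<eta> / 2\<close> times the squared gradient variation, plus a difference of
  divergences weighted by the step parameter. All quadratic errors (change of the gradient along
  the movement, curvature of the constraints, their change between consecutive decisions) are
  multiples of squared movements, and the step parameters are large enough to pay for them
  through Pinsker's inequality.

  Summing over a window of rounds (\<open>window_inequality\<close>), the divergence differences cost at most
  the last step parameter times \<open>ln (T d)\<close> up to constants: mixing with the barycentre keeps every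
  divergence below \<open>ln (T d)\<close>, and the step parameters are nondecreasing. With a feasible comparison
  point the constraint terms are nonpositive, hence the regret is at most a constant times
  \<open>\<gamma>\<^sup>2 + \<alpha> T * ln (T d)\<close>.

  It remains to bound the step parameters, that is, the dual iterates (\<open>dual_bound\<close>). Here the
  comparison point is the Slater point and the window has length of order \<open>ln (T d)\<close> and ends where
  the dual norm is maximal. The potential then essentially does not decrease over the window,
  while each round contributes a negative term proportional to the dual norm. As the step parameter
  occurs only once per window, a window of this length suffices to show that the dual iterates are
  of order \<open>\<gamma> * ln (T d)\<close>. Consequently \<open>\<alpha> T\<close> is of order \<open>\<gamma>\<^sup>2 * ln (T d)\<close>, and
  \<open>\<gamma>\<^sup>2 = sqrt (V + Lf\<^sup>2 + 1)\<close> is at most twice the maximum of \<open>1\<close>, \<open>sqrt V\<close> and \<open>Lf\<close>.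
\<close>

section \<open>Vectors and the probability simplex\<close>

lemma lookup_scaleR: "Poly_Mapping.lookup (c *\<^sub>R x) i = c * Poly_Mapping.lookup x i"
  for x :: rvec
proof -
  have "finite {i. c * Poly_Mapping.lookup x i \<noteq> 0}"
    by (rule finite_subset[OF _ finite_keys[of x]]) (auto simp: in_keys_iff)
  then show ?thesis
    by (simp add: scaleR_poly_mapping_def)
qed

lemma lookup_ones: "i \<in> {1..d} \<Longrightarrow> Poly_Mapping.lookup (ones d) i = 1"
  by (simp add: ones_def lookup_sum lookup_single when_def)

lemma Rd_iff: "x \<in> Rd d \<longleftrightarrow> (\<forall>i. i \<notin> {1..d} \<longrightarrow> Poly_Mapping.lookup x i = 0)"
  by (auto simp: Rd_def in_keys_iff)

lemma Rd_add: "x \<in> Rd d \<Longrightarrow> y \<in> Rd d \<Longrightarrow> x + y \<in> Rd d"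
  and Rd_diff: "x \<in> Rd d \<Longrightarrow> y \<in> Rd d \<Longrightarrow> x - y \<in> Rd d"
  and Rd_scaleR: "x \<in> Rd d \<Longrightarrow> c *\<^sub>R x \<in> Rd d"
  by (simp_all add: Rd_iff lookup_add lookup_minus lookup_scaleR)

lemma ones_in_Rd: "ones d \<in> Rd d"
  by (auto simp: Rd_iff ones_def lookup_sum lookup_single when_def)

lemma dot_add_left: "dot d (v + w) x = dot d v x + dot d w x"
  and dot_diff_left: "dot d (v - w) x = dot d v x - dot d w x"
  and dot_diff_right: "dot d v (x - y) = dot d v x - dot d v y"
  and dot_scaleR_left: "dot d (c *\<^sub>R v) x = c * dot d v x"
  and dot_scaleR_right: "dot d v (c *\<^sub>R x) = c * dot d v x"
  by (simp_all add: dot_def lookup_add lookup_minus lookup_scaleR algebra_simps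
      sum.distrib sum_subtractf sum_distrib_left)

lemma dot_sum_left: "dot d (\<Sum>k\<in>A. v k) x = (\<Sum>k\<in>A. dot d (v k) x)"
  unfolding dot_def lookup_sum sum_distrib_right by (rule sum.swap)

lemma abs_lookup_le_norm_inf: "i \<in> {1..d} \<Longrightarrow> \<bar>Poly_Mapping.lookup v i\<bar> \<le> norm_inf d v"
  by (simp add: norm_inf_def)

lemma norm_inf_nonneg: "1 \<le> d \<Longrightarrow> 0 \<le> norm_inf d v"
  using abs_lookup_le_norm_inf[of 1 d v] by simp

lemma norm_inf_le:
  assumes "1 \<le> d" "\<And>i. i \<in> {1..d} \<Longrightarrow> \<bar>Poly_Mapping.lookup v i\<bar> \<le> c"
  shows "norm_inf d v \<le> c"
  using assms by (auto simp: norm_inf_def)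

lemma norm_inf_triangle:
  assumes "1 \<le> d"
  shows "norm_inf d (v + w) \<le> norm_inf d v + norm_inf d w"
    and "norm_inf d (v - w) \<le> norm_inf d v + norm_inf d w"
  using abs_lookup_le_norm_inf[of _ d v] abs_lookup_le_norm_inf[of _ d w]
  by (auto intro!: norm_inf_le[OF assms] simp: lookup_add lookup_minus; smt (verit))+

lemma abs_dot_le:
  assumes "x \<in> Rd d"
  shows "\<bar>dot d v x\<bar> \<le> norm_inf d v * norm x"
proof -
  have "\<bar>dot d v x\<bar> \<le> (\<Sum>i = 1..d. \<bar>Poly_Mapping.lookup v i\<bar> * \<bar>Poly_Mapping.lookup x i\<bar>)"
    unfolding dot_def abs_mult[symmetric] by (rule sum_abs)
  also have "\<dots> \<le> (\<Sum>i = 1..d. norm_inf d v * \<bar>Poly_Mapping.lookup x i\<bar>)"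
    by (intro sum_mono mult_right_mono abs_lookup_le_norm_inf) auto
  finally show ?thesis
    using assms by (simp add: norm_Rd sum_distrib_left)
qed

lemma prob_simplex_iff:
  "x \<in> prob_simplex d \<longleftrightarrow> x \<in> Rd d \<and> (\<Sum>i = 1..d. Poly_Mapping.lookup x i) = 1
     \<and> (\<forall>i\<in>{1..d}. 0 \<le> Poly_Mapping.lookup x i)"
  by (auto simp: prob_simplex_def norm_Rd)

lemma prob_simplexD:
  assumes "x \<in> prob_simplex d"
  shows "x \<in> Rd d" "norm x = 1" "(\<Sum>i = 1..d. Poly_Mapping.lookup x i) = 1"
    and "i \<in> {1..d} \<Longrightarrow> 0 \<le> Poly_Mapping.lookup x i"
    and "i \<in> {1..d} \<Longrightarrow> Poly_Mapping.lookup x i \<le> 1"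
proof -
  show "x \<in> Rd d" "norm x = 1"
    using assms by (auto simp: prob_simplex_def)
  show sum1: "(\<Sum>i = 1..d. Poly_Mapping.lookup x i) = 1"
    using assms by (simp add: prob_simplex_iff)
  show nonneg: "0 \<le> Poly_Mapping.lookup x i" if "i \<in> {1..d}" for i
    using assms that by (auto simp: prob_simplex_iff)
  show "Poly_Mapping.lookup x i \<le> 1" if "i \<in> {1..d}"
    using member_le_sum[of i "{1..d}" "Poly_Mapping.lookup x"] that nonneg sum1 by auto
qed

lemma prob_simplex_convex_combination:
  assumes "x \<in> prob_simplex d" "y \<in> prob_simplex d" "0 \<le> s" "s \<le> 1"
  shows "(1 - s) *\<^sub>R x + s *\<^sub>R y \<in> prob_simplex d"
  using assms
  by (auto simp: prob_simplex_iff Rd_add Rd_scaleR lookup_add lookup_scaleR sum.distrib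
      simp flip: sum_distrib_left)

lemma barycentre_in_prob_simplex: "1 \<le> d \<Longrightarrow> (1 / real d) *\<^sub>R ones d \<in> prob_simplex d"
  using lookup_ones[of _ d]
  by (auto simp: prob_simplex_iff Rd_scaleR ones_in_Rd lookup_scaleR)

lemma norm_diff_prob_simplex_le: "x \<in> prob_simplex d \<Longrightarrow> y \<in> prob_simplex d \<Longrightarrow> norm (x - y) \<le> 2"
  using norm_triangle_ineq4[of x y] by (simp add: prob_simplexD)

section \<open>Entropy and the prox step\<close>

text \<open>
  Scalar core of Pinsker's inequality. Dividing by \<open>2 t + 4\<close> and rewriting
  \<open>(t - 1)\<^sup>2 / (t + 2)\<close> as \<open>t + 2 - 6 + 9 / (t + 2)\<close> leaves a function whose value and
  derivative both vanish at \<open>1\<close> and whose second derivative \<open>1 / t - 27 / (t + 2) ^ 3\<close> is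
  nonnegative by the inequality of arithmetic and geometric means for \<open>t, 1, 1\<close>.
\<close>
lemma entropy_remainder_ge:
  fixes t :: real
  assumes "0 < t"
  shows "3 * (t - 1)\<^sup>2 \<le> (2 * t + 4) * (t * ln t - t + 1)"
proof -
  define \<phi> where "\<phi> t = t * ln t - t + 1 - 3 / 2 * (t + 2 - 6 + 9 / (t + 2))" for t :: real
  define \<phi>' where "\<phi>' t = ln t - 3 / 2 * (1 - 9 / (t + 2)\<^sup>2)" for t :: real
  have d1: "(\<phi> has_real_derivative \<phi>' s) (at s)" if "0 < s" for s
    unfolding \<phi>_def \<phi>'_def using that
    by (auto intro!: derivative_eq_intros simp: field_simps power2_eq_square)
  have d2: "(\<phi>' has_real_derivative 1 / s - 27 / (s + 2) ^ 3) (at s)" if "0 < s" for s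
  proof -
    have u: "((\<lambda>u. 9 / u\<^sup>2) has_real_derivative - 18 / u ^ 3) (at u)" if "0 < u" for u :: real
      using that
      by (auto intro!: derivative_eq_intros simp: field_simps power2_eq_square power3_eq_cube)
    have "((\<lambda>t. 9 / (t + 2)\<^sup>2) has_real_derivative - 18 / (s + 2) ^ 3) (at s)"
      using u[of "s + 2"] that by (simp add: DERIV_shift)
    note deriv = DERIV_diff[OF DERIV_ln_divide[OF that] DERIV_cmult[OF DERIV_diff[OF DERIV_const this]]]
    show ?thesis
      using deriv[of "3 / 2" 1] by (simp add: \<phi>'_def[abs_def])
  qed
  have d2_nonneg: "0 \<le> 1 / s - 27 / (s + 2) ^ 3" if "0 < s" for s :: real
  proof -
    have "(s + 2) ^ 3 - 27 * s = (s - 1)\<^sup>2 * (s + 8)"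
      by (simp add: power2_eq_square power3_eq_cube algebra_simps)
    moreover have "0 \<le> (s - 1)\<^sup>2 * (s + 8)"
      using that by simp
    ultimately show ?thesis
      using that by (simp add: divide_simps)
  qed
  have mono: "\<phi>' a \<le> \<phi>' b" if "0 < a" "a \<le> b" for a b
  proof (rule DERIV_nonneg_imp_nondecreasing[OF that(2)])
    fix s assume "a \<le> s" "s \<le> b"
    with that have "0 < s" by simp
    then show "\<exists>y. (\<phi>' has_real_derivative y) (at s) \<and> 0 \<le> y"
      using d2 d2_nonneg by blast
  qed
  have \<phi>'1: "\<phi>' 1 = 0" and \<phi>1: "\<phi> 1 = 0"
    by (simp_all add: \<phi>'_def \<phi>_def)
  have "0 \<le> \<phi> t"
  proof (cases "1 \<le> t")
    case True
    have "\<phi> 1 \<le> \<phi> t"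
    proof (rule DERIV_nonneg_imp_nondecreasing[OF True])
      fix s :: real assume "1 \<le> s" "s \<le> t"
      then have "0 < s" "0 \<le> \<phi>' s"
        using mono[of 1 s] \<phi>'1 by auto
      then show "\<exists>y. (\<phi> has_real_derivative y) (at s) \<and> 0 \<le> y"
        using d1 by blast
    qed
    then show ?thesis by (simp add: \<phi>1)
  next
    case False
    have "\<phi> 1 \<le> \<phi> t"
    proof (rule DERIV_nonpos_imp_nonincreasing[where f = \<phi>])
      fix s :: real assume "t \<le> s" "s \<le> 1"
      then have "0 < s" "\<phi>' s \<le> 0"
        using mono[of s 1] \<phi>'1 assms by auto
      then show "\<exists>y. (\<phi> has_real_derivative y) (at s) \<and> y \<le> 0"
        using d1 by blast
    qed (use False in simp)
    then show ?thesis by (simp add: \<phi>1)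
  qed
  moreover have "(2 * t + 4) * \<phi> t = (2 * t + 4) * (t * ln t - t + 1) - 3 * (t - 1)\<^sup>2"
    using assms unfolding \<phi>_def by (simp add: field_simps power2_eq_square)
  ultimately show ?thesis
    using assms mult_nonneg_nonneg[of "2 * t + 4" "\<phi> t"] by simp
qed

text \<open>
  The linear terms \<open>b - a\<close> make every summand of the divergence nonnegative and cancel when two
  probability vectors are compared. The weights \<open>(2 a + 4 b) / 3\<close> then add up to \<open>2\<close>, which is
  the constant in Pinsker's inequality.
\<close>
lemma KL_summand_ge:
  fixes a b :: real
  assumes "0 \<le> a" "0 < b"
  shows "0 \<le> a * ln (a / b) - a + b"
    and "(a - b)\<^sup>2 \<le> (2 * a + 4 * b) / 3 * (a * ln (a / b) - a + b)"
proof -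
  show sq: "(a - b)\<^sup>2 \<le> (2 * a + 4 * b) / 3 * (a * ln (a / b) - a + b)"
  proof (cases "a = 0")
    case True
    then show ?thesis using assms by (simp add: power2_eq_square)
  next
    case False
    define t where "t = a / b"
    have "0 < t" and a: "a = t * b"
      using False assms by (auto simp: t_def)
    have "b\<^sup>2 * (3 * (t - 1)\<^sup>2) \<le> b\<^sup>2 * ((2 * t + 4) * (t * ln t - t + 1))"
      by (intro mult_left_mono entropy_remainder_ge \<open>0 < t\<close>) simp
    then show ?thesis
      using assms unfolding a by (simp add: power2_eq_square algebra_simps)
  qed
  show "0 \<le> a * ln (a / b) - a + b"
    using order_trans[OF zero_le_power2 sq] assms by (simp add: zero_le_mult_iff)
qed

text \<open>
  Strong convexity of the entropy with respect to the 1-norm: the Cauchy-Schwarz inequality applied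
  to the summandwise estimate.
\<close>
lemma Pinsker:
  assumes x: "x \<in> prob_simplex d" and y: "y \<in> prob_simplex d"
    and pos: "\<And>i. i \<in> {1..d} \<Longrightarrow> 0 < Poly_Mapping.lookup y i"
  shows "(norm (x - y))\<^sup>2 / 2 \<le> KL d x y"
proof -
  let ?a = "Poly_Mapping.lookup x" and ?b = "Poly_Mapping.lookup y"
  define r where "r i = ?a i * ln (?a i / ?b i) - ?a i + ?b i" for i
  define w where "w i = (2 * ?a i + 4 * ?b i) / 3" for i
  have r: "0 \<le> r i" "0 \<le> w i" "\<bar>?a i - ?b i\<bar> \<le> sqrt (w i) * sqrt (r i)" if "i \<in> {1..d}" for i
    using KL_summand_ge[of "?a i" "?b i"] prob_simplexD(4)[OF x that] pos[OF that]
      real_sqrt_le_mono[of "(?a i - ?b i)\<^sup>2" "w i * r i"]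
    by (auto simp: r_def w_def simp flip: real_sqrt_mult)
  have "norm (x - y) = (\<Sum>i = 1..d. \<bar>?a i - ?b i\<bar>)"
    using x y by (simp add: norm_Rd[of _ d] Rd_diff prob_simplexD(1) lookup_minus)
  also have "\<dots> \<le> (\<Sum>i = 1..d. sqrt (w i) * sqrt (r i))"
    by (intro sum_mono r)
  finally have "(norm (x - y))\<^sup>2 \<le> (\<Sum>i = 1..d. sqrt (w i) * sqrt (r i))\<^sup>2"
    by (intro power_mono) auto
  also have "\<dots> \<le> (\<Sum>i = 1..d. (sqrt (w i))\<^sup>2) * (\<Sum>i = 1..d. (sqrt (r i))\<^sup>2)"
    by (rule Cauchy_Schwarz_ineq_sum)
  also have "\<dots> = (\<Sum>i = 1..d. w i) * (\<Sum>i = 1..d. r i)"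
    using r by simp
  also have "(\<Sum>i = 1..d. w i) = 2"
    using prob_simplexD(3)[OF x] prob_simplexD(3)[OF y]
    by (simp add: w_def sum.distrib flip: sum_divide_distrib sum_distrib_left)
  also have "(\<Sum>i = 1..d. r i) = KL d x y"
    using prob_simplexD(3)[OF x] prob_simplexD(3)[OF y]
    by (simp add: r_def KL_def sum.distrib sum_subtractf)
  finally show ?thesis by simp
qed

corollary KL_nonneg:
  assumes "x \<in> prob_simplex d" "y \<in> prob_simplex d"
    and "\<And>i. i \<in> {1..d} \<Longrightarrow> 0 < Poly_Mapping.lookup y i"
  shows "0 \<le> KL d x y"
  using order_trans[OF _ Pinsker[OF assms]] by simp

lemma KL_self: "KL d x x = 0"
  by (auto simp: KL_def intro!: sum.neutral)

text \<open>
  A linear function plus a multiple of \<open>KL _ y\<close> equals, up to an additive constant, the same multiple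
  of \<open>KL _ w\<close>, where \<open>w\<close> is proportional to \<open>y i * exp (- v i / a)\<close>. By Pinsker's inequality \<open>w\<close>
  is therefore the only minimiser. This shows that the minimiser lies in the relative interior of the
  simplex, and it turns the usual three-point inequality of mirror descent into an identity.
\<close>
lemma prox_step:
  assumes d: "1 \<le> d" and y: "y \<in> prob_simplex d"
    and pos: "\<And>i. i \<in> {1..d} \<Longrightarrow> 0 < Poly_Mapping.lookup y i"
    and a: "0 < a"
    and u: "is_arg_min (\<lambda>x. dot d v x + a * KL d x y) (\<lambda>x. x \<in> prob_simplex d) u"
  shows "u \<in> prob_simplex d"
    and "i \<in> {1..d} \<Longrightarrow> 0 < Poly_Mapping.lookup u i"
    and "z \<in> prob_simplex d \<Longrightarrow>
      dot d v z + a * KL d z y = dot d v u + a * KL d u y + a * KL d z u"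
proof -
  define e where "e i = Poly_Mapping.lookup y i * exp (- Poly_Mapping.lookup v i / a)" for i
  define Z where "Z = (\<Sum>i = 1..d. e i)"
  define w where "w = (\<Sum>i = 1..d. Poly_Mapping.single i (e i / Z))"
  have e: "0 < e i" if "i \<in> {1..d}" for i
    using pos[OF that] by (simp add: e_def)
  have Z: "0 < Z"
    unfolding Z_def using d by (intro sum_pos e) auto
  have lookup_w: "Poly_Mapping.lookup w i = (if i \<in> {1..d} then e i / Z else 0)" for i
    by (auto simp: w_def lookup_sum lookup_single when_def)
  have wpos: "0 < Poly_Mapping.lookup w i" if "i \<in> {1..d}" for i
    using e[OF that] Z that by (simp add: lookup_w)
  have w: "w \<in> prob_simplex d"
    using wpos Z by (auto simp: prob_simplex_iff Rd_iff lookup_w Z_def less_imp_le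
        simp flip: sum_divide_distrib)
  have gibbs: "dot d v z + a * KL d z y = a * KL d z w - a * ln Z"
    if z: "z \<in> prob_simplex d" for z
  proof -
    let ?z = "Poly_Mapping.lookup z"
    have "?z i * ln (?z i / Poly_Mapping.lookup w i)
        = ?z i * ln (?z i / Poly_Mapping.lookup y i)
          + Poly_Mapping.lookup v i * ?z i / a + ?z i * ln Z" if i: "i \<in> {1..d}" for i
    proof (cases "?z i = 0")
      case False
      then have "0 < ?z i"
        using prob_simplexD(4)[OF z i] by simp
      then show ?thesis
        using pos[OF i] e[OF i] Z i a
        by (simp add: lookup_w ln_div ln_mult ln_mult_pos e_def algebra_simps)
    qed simp
    then have "KL d z w = KL d z y + dot d v z / a + ln Z"
      using prob_simplexD(3)[OF z]
      by (simp add: KL_def dot_def sum.distrib flip: sum_divide_distrib sum_distrib_right)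
    then show ?thesis
      using a by (simp add: algebra_simps)
  qed
  show u': "u \<in> prob_simplex d"
    using u by (simp add: is_arg_min_def)
  have "dot d v u + a * KL d u y \<le> dot d v w + a * KL d w y"
    using u w by (simp add: is_arg_min_linorder)
  then have "KL d u w \<le> 0"
    using gibbs[OF u'] gibbs[OF w] a by (simp add: KL_self mult_le_0_iff)
  then have "(norm (u - w))\<^sup>2 \<le> 0"
    using Pinsker[OF u' w wpos] by linarith
  then have uw: "u = w" by simp
  show "0 < Poly_Mapping.lookup u i" if "i \<in> {1..d}"
    using wpos[OF that] by (simp add: uw)
  show "dot d v z + a * KL d z y = dot d v u + a * KL d u y + a * KL d z u"
    if "z \<in> prob_simplex d"
    using gibbs[OF that] gibbs[OF w] by (simp add: uw KL_self)
qed

lemma KL_le_ln_inverse: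
  assumes x: "x \<in> prob_simplex d" and c: "0 < c"
    and y: "\<And>i. i \<in> {1..d} \<Longrightarrow> c \<le> Poly_Mapping.lookup y i"
  shows "KL d x y \<le> ln (1 / c)"
proof -
  have "Poly_Mapping.lookup x i * ln (Poly_Mapping.lookup x i / Poly_Mapping.lookup y i)
      \<le> Poly_Mapping.lookup x i * ln (1 / c)" if i: "i \<in> {1..d}" for i
  proof (cases "Poly_Mapping.lookup x i = 0")
    case False
    then have "0 < Poly_Mapping.lookup x i" "Poly_Mapping.lookup x i \<le> 1"
      using prob_simplexD(4,5)[OF x i] by auto
    then show ?thesis
      using c y[OF i] by (intro mult_left_mono ln_mono frac_le) auto
  qed simp
  then have "KL d x y \<le> (\<Sum>i = 1..d. Poly_Mapping.lookup x i * ln (1 / c))"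
    unfolding KL_def by (rule sum_mono)
  then show ?thesis
    by (simp add: prob_simplexD(3)[OF x] del: One_nat_def flip: sum_distrib_right)
qed

text \<open>
  Used to return from the mixed prox centre to the intermediate iterate: mixing with the barycentre
  shrinks no coordinate by more than the factor \<open>1 - \<nu>\<close>.
\<close>
lemma KL_mixing_le:
  assumes x: "x \<in> prob_simplex d" and s: "0 < s"
    and y: "\<And>i. i \<in> {1..d} \<Longrightarrow> 0 < Poly_Mapping.lookup y i"
    and le: "\<And>i. i \<in> {1..d} \<Longrightarrow> s * Poly_Mapping.lookup y i \<le> Poly_Mapping.lookup y' i"
  shows "KL d x y' \<le> KL d x y + ln (1 / s)"
proof -
  have "Poly_Mapping.lookup x i * ln (Poly_Mapping.lookup x i / Poly_Mapping.lookup y' i)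
      \<le> Poly_Mapping.lookup x i * ln (Poly_Mapping.lookup x i / Poly_Mapping.lookup y i)
        + Poly_Mapping.lookup x i * ln (1 / s)" if i: "i \<in> {1..d}" for i
  proof (cases "Poly_Mapping.lookup x i = 0")
    case False
    then have pos: "0 < Poly_Mapping.lookup x i"
      using prob_simplexD(4)[OF x i] by auto
    have "ln (Poly_Mapping.lookup x i / Poly_Mapping.lookup y' i)
        \<le> ln (Poly_Mapping.lookup x i / (s * Poly_Mapping.lookup y i))"
      using le[OF i] y[OF i] s pos
      by (intro ln_mono divide_left_mono divide_pos_pos mult_pos_pos) (auto intro: less_le_trans[OF mult_pos_pos])
    also have "\<dots> = ln (Poly_Mapping.lookup x i / Poly_Mapping.lookup y i) + ln (1 / s)"
      using y[OF i] s pos by (simp add: ln_div ln_mult)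
    finally show ?thesis
      using pos by (simp add: mult_left_mono flip: distrib_left)
  qed simp
  then have "KL d x y' \<le> (\<Sum>i = 1..d. Poly_Mapping.lookup x i
      * ln (Poly_Mapping.lookup x i / Poly_Mapping.lookup y i) + Poly_Mapping.lookup x i * ln (1 / s))"
    unfolding KL_def by (rule sum_mono)
  then show ?thesis
    by (simp add: KL_def sum.distrib prob_simplexD(3)[OF x] del: One_nat_def flip: sum_distrib_right)
qed

section \<open>Convex functions on the simplex\<close>

text \<open>
  Gradients are only defined within the simplex, so all first-order estimates are reduced to one
  real variable by restricting to a segment of the simplex.
\<close>
lemma has_real_derivative_along_segment:
  assumes x: "x \<in> prob_simplex d" and z: "z \<in> prob_simplex d" and s: "s \<in> {0..1}"
    and grad: "is_gradient d f (x + s *\<^sub>R (z - x)) v"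
  shows "((\<lambda>r. f (x + r *\<^sub>R (z - x))) has_real_derivative dot d v (z - x)) (at s within {0..1})"
proof -
  have "x + r *\<^sub>R (z - x) \<in> prob_simplex d" if "r \<in> {0..1}" for r
    using prob_simplex_convex_combination[OF x z, of r] that by (simp add: algebra_simps)
  then have "(\<lambda>r. x + r *\<^sub>R (z - x)) ` {0..1} \<subseteq> prob_simplex d"
    by auto
  then have "(f has_derivative (\<lambda>h. dot d v h))
      (at (x + s *\<^sub>R (z - x)) within (\<lambda>r. x + r *\<^sub>R (z - x)) ` {0..1})"
    using grad by (auto simp: is_gradient_def intro: has_derivative_subset)
  moreover have "((\<lambda>r. x + r *\<^sub>R (z - x)) has_derivative (\<lambda>h. h *\<^sub>R (z - x))) (at s within {0..1})"
    using has_derivative_add[OF has_derivative_const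
        bounded_linear_imp_has_derivative[OF bounded_linear_scaleR_left]] by simp
  ultimately have "((\<lambda>r. f (x + r *\<^sub>R (z - x))) has_derivative (\<lambda>h. dot d v (h *\<^sub>R (z - x))))
      (at s within {0..1})"
    by (rule has_derivative_in_compose[rotated])
  then show ?thesis
    by (simp add: has_field_derivative_def dot_scaleR_right mult_commute_abs)
qed

text \<open>
  The difference quotients along the segment are at most \<open>f z - f x\<close> by convexity; the derivative
  at the left endpoint is their limit.
\<close>
lemma convex_diff_above_tangent:
  assumes f: "convex_diff d f df" and x: "x \<in> prob_simplex d" and z: "z \<in> prob_simplex d"
  shows "f x + dot d (df x) (z - x) \<le> f z"
proof -
  define \<phi> where "\<phi> r = f (x + r *\<^sub>R (z - x))" for r
  have "is_gradient d f (x + 0 *\<^sub>R (z - x)) (df x)"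
    using f x by (simp add: convex_diff_def)
  then have "(\<phi> has_real_derivative dot d (df x) (z - x)) (at 0 within {0..1})"
    unfolding \<phi>_def by (intro has_real_derivative_along_segment x z) auto
  then have "((\<lambda>r. (\<phi> r - \<phi> 0) / (r - 0)) \<longlongrightarrow> dot d (df x) (z - x)) (at 0 within {0..1})"
    by (simp add: has_field_derivative_iff)
  moreover have "\<forall>\<^sub>F r in at 0 within {0..1}. (\<phi> r - \<phi> 0) / (r - 0) \<le> f z - f x"
  proof -
    have "(\<phi> r - \<phi> 0) / (r - 0) \<le> f z - f x" if "0 < r" "r \<le> 1" for r
    proof -
      have "convex_on (prob_simplex d) f"
        using f by (simp add: convex_diff_def)
      then have "f ((1 - r) *\<^sub>R x + r *\<^sub>R z) \<le> (1 - r) * f x + r * f z"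
        using that x z by (intro convex_onD) auto
      then have "\<phi> r - \<phi> 0 \<le> r * (f z - f x)"
        by (simp add: \<phi>_def algebra_simps)
      then show ?thesis
        using that by (simp add: field_simps)
    qed
    then show ?thesis
      by (auto simp: eventually_at_filter intro!: always_eventually)
  qed
  moreover have "at (0::real) within {0..1} \<noteq> bot"
    by (simp add: trivial_limit_within islimpt_Icc)
  ultimately have "dot d (df x) (z - x) \<le> f z - f x"
    by (intro tendsto_upperbound)
  then show ?thesis by simp
qed

text \<open>
  The constant \<open>L / 2\<close> matters: the factor \<open>3\<close> in the step parameters leaves no room for the weaker
  bound with \<open>L\<close> that follows from convexity alone.
\<close>
lemma convex_diff_descent:
  assumes f: "convex_diff d f df" and x: "x \<in> prob_simplex d" and z: "z \<in> prob_simplex d"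
    and lip: "\<And>u w. u \<in> prob_simplex d \<Longrightarrow> w \<in> prob_simplex d \<Longrightarrow>
      norm_inf d (df u - df w) \<le> L * norm (u - w)"
  shows "f z \<le> f x + dot d (df x) (z - x) + L / 2 * (norm (z - x))\<^sup>2"
proof -
  define \<phi> where "\<phi> r = f (x + r *\<^sub>R (z - x))" for r
  define \<psi> where "\<psi> r = \<phi> r - r * dot d (df x) (z - x) - L / 2 * (norm (z - x))\<^sup>2 * r\<^sup>2" for r
  have mem: "x + r *\<^sub>R (z - x) \<in> prob_simplex d" if "r \<in> {0..1}" for r
    using prob_simplex_convex_combination[OF x z, of r] that by (simp add: algebra_simps)
  have deriv: "(\<phi> has_real_derivative dot d (df (x + r *\<^sub>R (z - x))) (z - x)) (at r within {0..1})"
    if "r \<in> {0..1}" for r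
    unfolding \<phi>_def using f mem[OF that] that
    by (intro has_real_derivative_along_segment x z) (auto simp: convex_diff_def)
  have "\<psi> 1 \<le> \<psi> 0"
  proof (rule DERIV_nonpos_imp_decreasing_open[where f = \<psi> and a = 0 and b = 1])
    have "continuous_on {0..1} \<phi>"
      by (rule DERIV_continuous_on[OF deriv])
    then show "continuous_on {0..1} \<psi>"
      unfolding \<psi>_def by (intro continuous_intros)
  next
    fix r :: real
    assume r: "0 < r" "r < 1"
    let ?u = "x + r *\<^sub>R (z - x)"
    have "(\<phi> has_real_derivative dot d (df ?u) (z - x)) (at r)"
      using deriv[of r] r by (simp add: at_within_Icc_at)
    then have "(\<psi> has_real_derivative
        dot d (df ?u) (z - x) - dot d (df x) (z - x) - L / 2 * (norm (z - x))\<^sup>2 * (2 * r)) (at r)"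
      unfolding \<psi>_def
      by (intro DERIV_diff DERIV_cmult) (auto intro!: derivative_eq_intros)
    moreover
    have "dot d (df ?u) (z - x) - dot d (df x) (z - x) \<le> L * (norm (z - x))\<^sup>2 * r"
    proof -
      have "dot d (df ?u - df x) (z - x) \<le> norm_inf d (df ?u - df x) * norm (z - x)"
        using abs_dot_le[of "z - x" d "df ?u - df x"] x z by (simp add: prob_simplexD(1) Rd_diff)
      also have "\<dots> \<le> (L * norm (?u - x)) * norm (z - x)"
        using mem[of r] x r by (intro mult_right_mono lip) auto
      also have "norm (?u - x) = r * norm (z - x)"
        using r by simp
      finally show ?thesis
        by (simp add: dot_diff_left power2_eq_square mult_ac)
    qed
    then have "dot d (df ?u) (z - x) - dot d (df x) (z - x) - L / 2 * (norm (z - x))\<^sup>2 * (2 * r) \<le> 0"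
      by (simp add: algebra_simps)
    ultimately show "\<exists>y. (\<psi> has_real_derivative y) (at r) \<and> y \<le> 0"
      by blast
  qed simp
  then show ?thesis
    by (simp add: \<psi>_def \<phi>_def)
qed

text \<open>
  Summation by parts: every \<open>D t\<close> with \<open>t \<le> n\<close> appears with a nonnegative coefficient, so it may be
  replaced by its upper bound.
\<close>
lemma sum_stepsize_telescope_le:
  fixes a D :: "nat \<Rightarrow> real"
  assumes "m \<le> n"
    and "\<And>t. m \<le> t \<Longrightarrow> t < n \<Longrightarrow> a t \<le> a (Suc t)" and "0 \<le> a m"
    and "\<And>t. m \<le> t \<Longrightarrow> t \<le> n \<Longrightarrow> D t \<le> L"
  shows "(\<Sum>t = m..n. a t * (D t - D (Suc t))) \<le> a n * (L - D (Suc n))"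
  using assms
proof (induction n rule: dec_induct)
  case base
  then show ?case by (simp add: mult_left_mono)
next
  case (step n)
  have "(a (Suc n) - a n) * D (Suc n) \<le> (a (Suc n) - a n) * L"
    using step.prems step.hyps by (intro mult_left_mono) auto
  moreover have "(\<Sum>t = m..n. a t * (D t - D (Suc t))) \<le> a n * (L - D (Suc n))"
    using step.prems by (intro step.IH) auto
  ultimately show ?case
    using step.hyps by (simp add: algebra_simps)
qed

section \<open>Runs of the algorithm\<close>

text \<open>
  The parameters \<open>\<eta>\<close>, \<open>\<gamma>\<close>, \<open>\<nu>\<close> stay free here, since the one-round analysis depends only on the
  form of the step parameters. They are tuned afterwards.
\<close>
locale mirror_prox =
  fixes d T K :: nat
    and f :: "nat \<Rightarrow> rvec \<Rightarrow> real" and df :: "nat \<Rightarrow> rvec \<Rightarrow> rvec"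
    and g :: "nat \<Rightarrow> rvec \<Rightarrow> real" and dg :: "nat \<Rightarrow> rvec \<Rightarrow> rvec"
    and F Lf G :: real and Hk :: "nat \<Rightarrow> real" and H Lg \<eta> \<gamma> \<nu> :: real
    and \<alpha> :: "nat \<Rightarrow> real" and x xt :: "nat \<Rightarrow> rvec" and Q :: "nat \<Rightarrow> nat \<Rightarrow> real"
  assumes d: "1 \<le> d"
    and f: "convex_diff d (f t) (df t)"
    and g: "k \<in> {1..K} \<Longrightarrow> convex_diff d (g k) (dg k)"
    and bounded_smooth: "bounded_smooth d K df g dg F Lf G Hk Lg"
    and H: "H = (\<Sum>k = 1..K. Hk k)"
    and \<eta>: "0 < \<eta>" and \<gamma>: "0 < \<gamma>" and \<nu>: "0 < \<nu>" "\<nu> \<le> 1 / 2"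
    and steps: "step_params K T \<eta> \<gamma> Lf G H Lg Q \<alpha>"
    and run: "mirror_prox_run d K T df g dg \<gamma> \<nu> \<alpha> x xt Q"
begin

lemma constants_nonneg: "0 \<le> F" "0 \<le> Lf" "0 \<le> G" "0 \<le> Lg" "k \<in> {1..K} \<Longrightarrow> 0 \<le> Hk k"
  using bounded_smooth by (auto simp: bounded_smooth_def)

lemma norm_inf_df_le: "u \<in> prob_simplex d \<Longrightarrow> norm_inf d (df t u) \<le> F"
  and df_lipschitz: "u \<in> prob_simplex d \<Longrightarrow> v \<in> prob_simplex d \<Longrightarrow>
    norm_inf d (df t u - df t v) \<le> Lf * norm (u - v)"
  and sum_abs_g_le: "u \<in> prob_simplex d \<Longrightarrow> (\<Sum>k = 1..K. \<bar>g k u\<bar>) \<le> G"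
  and g_lipschitz: "k \<in> {1..K} \<Longrightarrow> u \<in> prob_simplex d \<Longrightarrow> v \<in> prob_simplex d \<Longrightarrow>
    \<bar>g k u - g k v\<bar> \<le> Hk k * norm (u - v)"
  and dg_lipschitz: "k \<in> {1..K} \<Longrightarrow> u \<in> prob_simplex d \<Longrightarrow> v \<in> prob_simplex d \<Longrightarrow>
    norm_inf d (dg k u - dg k v) \<le> Lg * norm (u - v)"
  using bounded_smooth by (auto simp: bounded_smooth_def)

text \<open>
  The dual iterates, continued by their recursion beyond the last round: the telescoping sum over
  the rounds ends with the dual vector of round \<open>T + 1\<close>, on which a run imposes no condition.
\<close>
primrec dual :: "nat \<Rightarrow> nat \<Rightarrow> real" where
  "dual k 0 = 0"
| "dual k (Suc t) = max (- \<gamma> * g k (x t)) (dual k t + \<gamma> * g k (x t))"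

lemma dual_nonneg: "0 \<le> dual k t"
proof (induction t)
  case (Suc t)
  then show ?case
    using \<gamma> by (cases "0 \<le> g k (x t)") (auto simp: max_def mult_le_0_iff)
qed simp

text \<open>
  For negative constraint values this is the first argument of the maximum, otherwise the second one.
  It keeps the negative term of the potential below the dual norm from round \<open>1\<close> on.
\<close>
lemma abs_g_le_dual: "\<gamma> * \<bar>g k (x t)\<bar> \<le> dual k (Suc t)"
  using dual_nonneg[of k t] by (auto simp: abs_if max_def)

lemma abs_dual_diff_le: "\<bar>dual k (Suc t) - dual k t\<bar> \<le> \<gamma> * \<bar>g k (x t)\<bar>"
  using dual_nonneg[of k t] \<gamma> by (cases "0 \<le> g k (x t)") (auto simp: abs_if max_def mult_nonneg_nonneg mult_le_0_iff)

lemma dual_drift: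
  "((dual k (Suc t))\<^sup>2 - (dual k t)\<^sup>2) / 2 \<le> \<gamma> * dual k t * g k (x t) + \<gamma>\<^sup>2 * (g k (x t))\<^sup>2"
proof -
  define q c where "q = dual k t" and "c = \<gamma> * g k (x t)"
  have "((max (- c) (q + c))\<^sup>2 - q\<^sup>2) / 2 \<le> q * c + c\<^sup>2"
  proof (cases "- c \<le> q + c")
    case True
    then show ?thesis by (simp add: power2_eq_square algebra_simps)
  next
    case False
    have "0 \<le> (q + c)\<^sup>2" by simp
    with False show ?thesis by (simp add: power2_eq_square algebra_simps)
  qed
  then show ?thesis
    by (simp add: q_def c_def power_mult_distrib mult_ac)
qed

lemma Q_eq_dual: "k \<in> {1..K} \<Longrightarrow> t \<le> T \<Longrightarrow> Q k t = dual k t"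
proof (induction t)
  case 0
  then show ?case using run by (simp add: mirror_prox_run_def)
next
  case (Suc t)
  then have "Q k (Suc t) = max (- \<gamma> * g k (x t)) (Q k t + \<gamma> * g k (x t))"
    using run by (auto simp: mirror_prox_run_def Let_def)
  with Suc show ?case by simp
qed

definition weight :: "nat \<Rightarrow> nat \<Rightarrow> real" where
  "weight k t = dual k t + \<gamma> * g k (x (t - 1))"

lemma weight_nonneg: "1 \<le> t \<Longrightarrow> 0 \<le> weight k t"
  using abs_g_le_dual[of k "t - 1"] \<gamma>
    mult_left_mono[OF abs_ge_minus_self[of "g k (x (t - 1))"], of \<gamma>]
  by (simp add: weight_def)

definition \<xi> :: "nat \<Rightarrow> real" where
  "\<xi> t = \<gamma> * Lg * (\<Sum>k = 1..K. dual k t) + \<gamma>\<^sup>2 * (Lg * G + H\<^sup>2)"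

lemma \<alpha>_0: "\<alpha> 0 = 0"
  using steps by (simp add: step_params_def)

lemma \<alpha>_eq:
  assumes "t \<in> {1..T}"
  shows "\<alpha> t = max (3 * (\<eta> * Lf\<^sup>2 + \<gamma>\<^sup>2 * Lg * G) + 2 / \<eta> + 3 * \<xi> t) (\<alpha> (t - 1))"
proof -
  have "(\<Sum>k = 1..K. \<bar>Q k t\<bar>) = (\<Sum>k = 1..K. dual k t)"
    using assms by (intro sum.cong) (auto simp: Q_eq_dual dual_nonneg)
  with steps assms show ?thesis
    by (auto simp: step_params_def Let_def \<xi>_def)
qed

lemma sum_dual_nonneg: "0 \<le> (\<Sum>k = 1..K. dual k t)"
  by (simp add: sum_nonneg dual_nonneg)

lemma \<xi>_nonneg: "0 \<le> \<xi> t"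
  unfolding \<xi>_def
  by (intro add_nonneg_nonneg mult_nonneg_nonneg sum_dual_nonneg constants_nonneg less_imp_le[OF \<gamma>]) auto

lemma \<alpha>_mono: "m \<le> n \<Longrightarrow> n \<le> T \<Longrightarrow> \<alpha> m \<le> \<alpha> n"
proof (induction n rule: dec_induct)
  case (step n)
  then show ?case
    using \<alpha>_eq[of "Suc n"] by simp
qed simp

lemma \<alpha>_ge:
  assumes "t \<in> {1..T}"
  shows "3 * (\<eta> * Lf\<^sup>2 + \<gamma>\<^sup>2 * Lg * G) + 2 / \<eta> + 3 * \<xi> t \<le> \<alpha> t"
  using \<alpha>_eq[OF assms] by simp

lemma \<alpha>_pos:
  assumes "t \<in> {1..T}"
  shows "2 / \<eta> \<le> \<alpha> t" "0 < \<alpha> t"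
proof -
  have "0 \<le> 3 * (\<eta> * Lf\<^sup>2 + \<gamma>\<^sup>2 * Lg * G) + 3 * \<xi> t"
    using \<eta> constants_nonneg \<xi>_nonneg[of t] by (intro add_nonneg_nonneg mult_nonneg_nonneg) auto
  then show "2 / \<eta> \<le> \<alpha> t"
    using \<alpha>_ge[OF assms] by simp
  moreover have "0 < 2 / \<eta>" using \<eta> by simp
  ultimately show "0 < \<alpha> t" by linarith
qed

definition centre :: "nat \<Rightarrow> rvec" where
  "centre t = (1 - \<nu>) *\<^sub>R xt t + (\<nu> / real d) *\<^sub>R ones d"

lemma x_in_prob_simplex: "t \<le> T \<Longrightarrow> x t \<in> prob_simplex d"
  using run barycentre_in_prob_simplex[OF d]
  by (cases "t = 0") (auto simp: mirror_prox_run_def Let_def is_arg_min_def)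

lemma xt_in_prob_simplex:
  assumes "t \<in> {1..Suc T}"
  shows "xt t \<in> prob_simplex d"
proof (cases "t = 1")
  case True
  then show ?thesis
    using run barycentre_in_prob_simplex[OF d] by (simp add: mirror_prox_run_def)
next
  case False
  then obtain s where s: "t = Suc s" "s \<in> {1..T}"
    using assms by (cases t) auto
  then show ?thesis
    using run by (auto simp: mirror_prox_run_def Let_def is_arg_min_def)
qed

lemma centre_in_prob_simplex:
  assumes "t \<in> {1..Suc T}"
  shows "centre t \<in> prob_simplex d"
  using prob_simplex_convex_combination[OF xt_in_prob_simplex[OF assms] barycentre_in_prob_simplex[OF d], of \<nu>] \<nu>
  by (simp add: centre_def)

lemma lookup_centre:
  "i \<in> {1..d} \<Longrightarrow> Poly_Mapping.lookup (centre t) i = (1 - \<nu>) * Poly_Mapping.lookup (xt t) i + \<nu> / real d"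
  by (simp add: centre_def lookup_add lookup_scaleR lookup_ones)

lemma lookup_centre_ge:
  assumes "t \<in> {1..Suc T}" "i \<in> {1..d}"
  shows "\<nu> / real d \<le> Poly_Mapping.lookup (centre t) i"
    and "(1 - \<nu>) * Poly_Mapping.lookup (xt t) i \<le> Poly_Mapping.lookup (centre t) i"
  using prob_simplexD(4)[OF xt_in_prob_simplex[OF assms(1)] assms(2)] \<nu> assms(2)
  by (auto simp: lookup_centre)

lemma centre_pos:
  assumes "t \<in> {1..Suc T}" "i \<in> {1..d}"
  shows "0 < Poly_Mapping.lookup (centre t) i"
  using lookup_centre_ge(1)[OF assms] \<nu> d by (auto intro: less_le_trans[rotated])

lemma norm_xt_centre_le:
  assumes "t \<in> {1..Suc T}"
  shows "norm (xt t - centre t) \<le> 2 * \<nu>"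
proof -
  have "xt t - centre t = \<nu> *\<^sub>R (xt t - (1 / real d) *\<^sub>R ones d)"
    by (simp add: centre_def algebra_simps)
  then show ?thesis
    using norm_diff_prob_simplex_le[OF xt_in_prob_simplex[OF assms] barycentre_in_prob_simplex[OF d]] \<nu>
    by (simp add: mult.commute)
qed

definition penalty_grad :: "nat \<Rightarrow> rvec" where
  "penalty_grad t = (\<Sum>k = 1..K. (\<gamma> * weight k t) *\<^sub>R dg k (x (t - 1)))"

lemma prox_objective_eq:
  assumes "t \<in> {1..T}"
  shows "prox_objective d K g dg \<gamma> v (\<lambda>k. Q k t) (x (t - 1)) (\<alpha> t) (centre t) z
    = dot d (v + penalty_grad t) z + \<alpha> t * KL d z (centre t)"
proof -
  have "(\<Sum>k = 1..K. (Q k t + \<gamma> * g k (x (t - 1))) * dot d (\<gamma> *\<^sub>R dg k (x (t - 1))) z)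
      = dot d (penalty_grad t) z"
    unfolding penalty_grad_def dot_sum_left using assms
    by (intro sum.cong) (auto simp: Q_eq_dual weight_def dot_scaleR_left)
  then show ?thesis
    by (simp add: prox_objective_def dot_add_left)
qed

lemma prox_argmin:
  assumes "t \<in> {1..T}"
  shows "is_arg_min (\<lambda>z. dot d (df (t - 1) (x (t - 1)) + penalty_grad t) z + \<alpha> t * KL d z (centre t))
      (\<lambda>z. z \<in> prob_simplex d) (x t)"
    and "is_arg_min (\<lambda>z. dot d (df t (x t) + penalty_grad t) z + \<alpha> t * KL d z (centre t))
      (\<lambda>z. z \<in> prob_simplex d) (xt (Suc t))"
proof -
  have *: "(\<lambda>z. dot d (v + penalty_grad t) z + \<alpha> t * KL d z (centre t))
      = prox_objective d K g dg \<gamma> v (\<lambda>k. Q k t) (x (t - 1)) (\<alpha> t) (centre t)" for v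
    using prox_objective_eq[OF assms] by auto
  show "is_arg_min (\<lambda>z. dot d (df (t - 1) (x (t - 1)) + penalty_grad t) z + \<alpha> t * KL d z (centre t))
      (\<lambda>z. z \<in> prob_simplex d) (x t)"
    and "is_arg_min (\<lambda>z. dot d (df t (x t) + penalty_grad t) z + \<alpha> t * KL d z (centre t))
      (\<lambda>z. z \<in> prob_simplex d) (xt (Suc t))"
    unfolding * using run assms
    by (simp_all add: mirror_prox_run_def Let_def centre_def)
qed

lemma x_pos:
  assumes t: "t \<in> {1..T}" and i: "i \<in> {1..d}"
  shows "0 < Poly_Mapping.lookup (x t) i"
  by (rule prox_step(2)[OF d centre_in_prob_simplex centre_pos \<alpha>_pos(2)[OF t] prox_argmin(1)[OF t] i])
     (use t in auto)

lemma xt_pos: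
  assumes t: "t \<in> {1..Suc T}" and i: "i \<in> {1..d}"
  shows "0 < Poly_Mapping.lookup (xt t) i"
proof (cases "t = 1")
  case True
  then show ?thesis
    using run i d by (simp add: mirror_prox_run_def lookup_scaleR lookup_ones)
next
  case False
  then have t': "t - 1 \<in> {1..T}" "Suc (t - 1) = t"
    using t by auto
  show ?thesis
    using prox_step(2)[OF d centre_in_prob_simplex centre_pos \<alpha>_pos(2)[OF t'(1)] prox_argmin(2)[OF t'(1)] i]
      t' by auto
qed

lemma KL_centre_le: "t \<in> {1..Suc T} \<Longrightarrow> z \<in> prob_simplex d \<Longrightarrow> KL d z (centre t) \<le> ln (real d / \<nu>)"
  using KL_le_ln_inverse[of z d "\<nu> / real d" "centre t"] lookup_centre_ge(1) \<nu> d by auto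

lemma KL_centre_nonneg: "t \<in> {1..Suc T} \<Longrightarrow> z \<in> prob_simplex d \<Longrightarrow> 0 \<le> KL d z (centre t)"
  by (intro KL_nonneg centre_in_prob_simplex centre_pos)

lemma KL_centre_le_KL_xt:
  assumes t: "t \<in> {1..Suc T}" and z: "z \<in> prob_simplex d"
  shows "KL d z (centre t) \<le> KL d z (xt t) + 2 * \<nu>"
proof -
  have "KL d z (centre t) \<le> KL d z (xt t) + ln (1 / (1 - \<nu>))"
    using \<nu> by (intro KL_mixing_le z xt_pos[OF t] lookup_centre_ge(2)[OF t]) auto
  also have "ln (1 / (1 - \<nu>)) \<le> 1 / (1 - \<nu>) - 1"
    using \<nu> by (intro ln_le_minus_one) auto
  also have "\<dots> \<le> 2 * \<nu>"
    using \<nu> by (simp add: field_simps)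
  finally show ?thesis by simp
qed

definition gradient_variation :: "nat \<Rightarrow> real" where
  "gradient_variation t = norm_inf d (df t (x t) - df (t - 1) (x t))"

text \<open>
  Adding the three-point identities of the two prox steps, the first one tested at the outcome of the
  second, leaves only the change of the loss gradient between the two steps. It splits into the
  variation over time and the Lipschitz term in \<open>x\<close>.
\<close>
lemma prox_pair_inequality:
  assumes t: "t \<in> {1..T}" and z: "z \<in> prob_simplex d"
  shows "dot d (df t (x t)) (x t - z) + dot d (penalty_grad t) (x t - z)
    \<le> (gradient_variation t + Lf * norm (x t - x (t - 1))) * norm (x t - xt (Suc t))
      + \<alpha> t * (KL d z (centre t) - KL d z (xt (Suc t)))
      - \<alpha> t / 2 * (norm (x t - xt (Suc t)))\<^sup>2 - \<alpha> t / 2 * (norm (x t - centre t))\<^sup>2"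
proof -
  have tt: "t \<in> {1..Suc T}" "Suc t \<in> {1..Suc T}" "t \<le> T" "t - 1 \<le> T"
    using t by auto
  note xs = x_in_prob_simplex[OF tt(3)] x_in_prob_simplex[OF tt(4)] and xts = xt_in_prob_simplex[OF tt(2)]
  let ?v0 = "df (t - 1) (x (t - 1))" and ?v1 = "df t (x t)" and ?p = "penalty_grad t"
  have "dot d (?v0 + ?p) (xt (Suc t)) + \<alpha> t * KL d (xt (Suc t)) (centre t)
      = dot d (?v0 + ?p) (x t) + \<alpha> t * KL d (x t) (centre t) + \<alpha> t * KL d (xt (Suc t)) (x t)"
    by (rule prox_step(3)[OF d centre_in_prob_simplex[OF tt(1)] centre_pos[OF tt(1)] \<alpha>_pos(2)[OF t]
          prox_argmin(1)[OF t] xts])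
  moreover have "dot d (?v1 + ?p) z + \<alpha> t * KL d z (centre t)
      = dot d (?v1 + ?p) (xt (Suc t)) + \<alpha> t * KL d (xt (Suc t)) (centre t) + \<alpha> t * KL d z (xt (Suc t))"
    by (rule prox_step(3)[OF d centre_in_prob_simplex[OF tt(1)] centre_pos[OF tt(1)] \<alpha>_pos(2)[OF t]
          prox_argmin(2)[OF t] z])
  ultimately have "dot d ?v1 (x t - z) + dot d ?p (x t - z)
      = dot d (?v1 - ?v0) (x t - xt (Suc t)) + \<alpha> t * (KL d z (centre t) - KL d z (xt (Suc t)))
        - \<alpha> t * KL d (xt (Suc t)) (x t) - \<alpha> t * KL d (x t) (centre t)"
    by (simp add: dot_add_left dot_diff_left dot_diff_right algebra_simps)
  moreover have "dot d (?v1 - ?v0) (x t - xt (Suc t))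
      \<le> (gradient_variation t + Lf * norm (x t - x (t - 1))) * norm (x t - xt (Suc t))"
  proof -
    have "?v1 - ?v0 = (df t (x t) - df (t - 1) (x t)) + (df (t - 1) (x t) - df (t - 1) (x (t - 1)))"
      by simp
    then have "norm_inf d (?v1 - ?v0) \<le> gradient_variation t + Lf * norm (x t - x (t - 1))"
      using norm_inf_triangle(1)[OF d, of "df t (x t) - df (t - 1) (x t)"
          "df (t - 1) (x t) - df (t - 1) (x (t - 1))"] df_lipschitz[OF xs, of "t - 1"]
      by (simp add: gradient_variation_def)
    then have "norm_inf d (?v1 - ?v0) * norm (x t - xt (Suc t))
        \<le> (gradient_variation t + Lf * norm (x t - x (t - 1))) * norm (x t - xt (Suc t))"
      by (rule mult_right_mono) simp
    then show ?thesis
      using abs_dot_le[of "x t - xt (Suc t)" d "?v1 - ?v0"] xs xts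
      by (simp add: Rd_diff prob_simplexD(1) abs_le_iff)
  qed
  moreover have "\<alpha> t * ((norm (x t - xt (Suc t)))\<^sup>2 / 2) \<le> \<alpha> t * KL d (xt (Suc t)) (x t)"
    using Pinsker[OF xts xs(1) x_pos[OF t]] \<alpha>_pos[OF t]
    by (intro mult_left_mono) (auto simp: norm_minus_commute)
  moreover have "\<alpha> t * ((norm (x t - centre t))\<^sup>2 / 2) \<le> \<alpha> t * KL d (x t) (centre t)"
    using Pinsker[OF xs(1) centre_in_prob_simplex[OF tt(1)] centre_pos[OF tt(1)]] \<alpha>_pos[OF t]
    by (intro mult_left_mono) auto
  ultimately show ?thesis by simp
qed

lemma sum_weight_bounds:
  assumes "1 \<le> t" "t \<le> T"
  shows "(\<Sum>k = 1..K. weight k t) \<le> (\<Sum>k = 1..K. dual k t) + \<gamma> * G"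
    and "(\<Sum>k = 1..K. dual k t) - \<gamma> * G \<le> (\<Sum>k = 1..K. weight k t)"
proof -
  have "\<bar>\<Sum>k = 1..K. g k (x (t - 1))\<bar> \<le> (\<Sum>k = 1..K. \<bar>g k (x (t - 1))\<bar>)"
    by (rule sum_abs)
  also have "\<dots> \<le> G"
    using assms by (intro sum_abs_g_le x_in_prob_simplex) auto
  finally have "\<bar>\<gamma> * (\<Sum>k = 1..K. g k (x (t - 1)))\<bar> \<le> \<gamma> * G"
    using \<gamma> by (simp add: abs_mult)
  then show "(\<Sum>k = 1..K. weight k t) \<le> (\<Sum>k = 1..K. dual k t) + \<gamma> * G"
    and "(\<Sum>k = 1..K. dual k t) - \<gamma> * G \<le> (\<Sum>k = 1..K. weight k t)"
    by (auto simp: weight_def sum.distrib simp flip: sum_distrib_left)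
qed

lemma sum_Hk_power2_le: "(\<Sum>k = 1..K. (Hk k)\<^sup>2) \<le> H\<^sup>2"
proof -
  have "(\<Sum>k = 1..K. (Hk k)\<^sup>2) \<le> (\<Sum>k = 1..K. Hk k * H)"
    unfolding power2_eq_square H using constants_nonneg(5)
    by (intro sum_mono mult_left_mono member_le_sum) auto
  then show ?thesis
    by (simp add: H power2_eq_square flip: sum_distrib_right)
qed

text \<open>
  The linearised penalty pays for the growth of the squared dual norm. Convexity bounds the
  linearisation at \<open>z\<close> and smoothness bounds it at the new decision. In the dual drift the product
  \<open>g k (x (t - 1)) * g k (x t)\<close>, which comes from the extra term \<open>\<gamma> * g k (x (t - 1))\<close> of the
  weights, turns the errors \<open>\<gamma>\<^sup>2 * (g k (x t))\<^sup>2\<close> into a telescoping difference and a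
  multiple of the squared movement.
\<close>
lemma penalty_inequality:
  assumes t: "t \<in> {1..T}" and z: "z \<in> prob_simplex d"
  shows "(\<Sum>k = 1..K. (dual k (Suc t))\<^sup>2) / 2 - (\<Sum>k = 1..K. (dual k t)\<^sup>2) / 2
      - \<gamma>\<^sup>2 / 2 * (\<Sum>k = 1..K. (g k (x t))\<^sup>2) + \<gamma>\<^sup>2 / 2 * (\<Sum>k = 1..K. (g k (x (t - 1)))\<^sup>2)
    \<le> dot d (penalty_grad t) (x t - z) + \<gamma> * (\<Sum>k = 1..K. weight k t * g k z)
      + \<xi> t / 2 * (norm (x t - x (t - 1)))\<^sup>2"
proof -
  define b where "b = norm (x t - x (t - 1))"
  have xs: "x t \<in> prob_simplex d" "x (t - 1) \<in> prob_simplex d"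
    using t by (auto intro!: x_in_prob_simplex)
  have each: "((dual k (Suc t))\<^sup>2 - (dual k t)\<^sup>2) / 2 - \<gamma>\<^sup>2 / 2 * ((g k (x t))\<^sup>2 - (g k (x (t - 1)))\<^sup>2)
      \<le> \<gamma> * weight k t * dot d (dg k (x (t - 1))) (x t - z) + \<gamma> * (weight k t * g k z)
        + \<gamma> * Lg / 2 * b\<^sup>2 * weight k t + \<gamma>\<^sup>2 / 2 * b\<^sup>2 * (Hk k)\<^sup>2" if k: "k \<in> {1..K}" for k
  proof -
    let ?g0 = "g k (x (t - 1))" and ?g1 = "g k (x t)" and ?w = "weight k t"
    let ?v = "dg k (x (t - 1))"
    have "?g1 \<le> ?g0 + dot d ?v (x t - x (t - 1)) + Lg / 2 * b\<^sup>2"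
      unfolding b_def by (intro convex_diff_descent g k xs dg_lipschitz)
    moreover have "?g0 + dot d ?v (z - x (t - 1)) \<le> g k z"
      by (intro convex_diff_above_tangent g k xs z)
    ultimately have "?g1 - g k z - Lg / 2 * b\<^sup>2 \<le> dot d ?v (x t - z)"
      by (simp add: dot_diff_right)
    then have "(\<gamma> * ?w) * (?g1 - g k z - Lg / 2 * b\<^sup>2) \<le> (\<gamma> * ?w) * dot d ?v (x t - z)"
      using weight_nonneg[of t k] \<gamma> t by (intro mult_left_mono) auto
    moreover have "((dual k (Suc t))\<^sup>2 - (dual k t)\<^sup>2) / 2 - \<gamma>\<^sup>2 * ?g1\<^sup>2 + \<gamma>\<^sup>2 * (?g0 * ?g1) \<le> \<gamma> * ?w * ?g1"
      using dual_drift[of k t] by (simp add: weight_def power2_eq_square algebra_simps)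
    moreover have "\<gamma>\<^sup>2 / 2 * (?g1 - ?g0)\<^sup>2 \<le> \<gamma>\<^sup>2 / 2 * (Hk k * b)\<^sup>2"
      using g_lipschitz[OF k xs] by (intro mult_left_mono power2_le_iff_abs_le[THEN iffD2])
        (auto simp: b_def constants_nonneg(5)[OF k])
    ultimately show ?thesis
      by (simp add: power2_eq_square algebra_simps)
  qed
  have "(\<Sum>k = 1..K. (dual k (Suc t))\<^sup>2) / 2 - (\<Sum>k = 1..K. (dual k t)\<^sup>2) / 2
      - \<gamma>\<^sup>2 / 2 * (\<Sum>k = 1..K. (g k (x t))\<^sup>2) + \<gamma>\<^sup>2 / 2 * (\<Sum>k = 1..K. (g k (x (t - 1)))\<^sup>2)
    = (\<Sum>k = 1..K. ((dual k (Suc t))\<^sup>2 - (dual k t)\<^sup>2) / 2 - \<gamma>\<^sup>2 / 2 * ((g k (x t))\<^sup>2 - (g k (x (t - 1)))\<^sup>2))"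
    by (simp add: sum_subtractf sum_divide_distrib sum_distrib_left right_diff_distrib diff_divide_distrib
        del: dual.simps)
  also have "\<dots> \<le> (\<Sum>k = 1..K. \<gamma> * weight k t * dot d (dg k (x (t - 1))) (x t - z)
      + \<gamma> * (weight k t * g k z) + \<gamma> * Lg / 2 * b\<^sup>2 * weight k t + \<gamma>\<^sup>2 / 2 * b\<^sup>2 * (Hk k)\<^sup>2)"
    by (intro sum_mono each)
  also have "\<dots> = dot d (penalty_grad t) (x t - z) + \<gamma> * (\<Sum>k = 1..K. weight k t * g k z)
      + \<gamma> * Lg / 2 * b\<^sup>2 * (\<Sum>k = 1..K. weight k t) + \<gamma>\<^sup>2 / 2 * b\<^sup>2 * (\<Sum>k = 1..K. (Hk k)\<^sup>2)"
    by (simp add: penalty_grad_def dot_sum_left dot_scaleR_left sum.distrib sum_distrib_left)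
  also have "\<dots> \<le> dot d (penalty_grad t) (x t - z) + \<gamma> * (\<Sum>k = 1..K. weight k t * g k z)
      + \<gamma> * Lg / 2 * b\<^sup>2 * ((\<Sum>k = 1..K. dual k t) + \<gamma> * G) + \<gamma>\<^sup>2 / 2 * b\<^sup>2 * H\<^sup>2"
    using sum_weight_bounds(1)[of t] sum_Hk_power2_le \<gamma> constants_nonneg t
    by (intro add_mono mult_left_mono order_refl) auto
  also have "\<dots> = dot d (penalty_grad t) (x t - z) + \<gamma> * (\<Sum>k = 1..K. weight k t * g k z) + \<xi> t / 2 * b\<^sup>2"
    by (simp add: \<xi>_def power2_eq_square algebra_simps)
  finally show ?thesis
    by (simp add: b_def)
qed

section \<open>The potential and its change in one round\<close>


text \<open>
  The last summand carries the part of \<open>\<alpha> (t - 1)\<close> that is left over in round \<open>t - 1\<close> from the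
  divergence between the decision and the intermediate iterate. Round \<open>t\<close> uses it to pay for the
  movement \<open>x t - x (t - 1)\<close>.
\<close>
definition potential :: "nat \<Rightarrow> real" where
  "potential t = (\<Sum>k = 1..K. (dual k t)\<^sup>2) / 2 - \<gamma>\<^sup>2 / 2 * (\<Sum>k = 1..K. (g k (x (t - 1)))\<^sup>2)
     + (\<alpha> (t - 1) / 2 - 1 / \<eta>) * (norm (x (t - 1) - xt t))\<^sup>2"

lemma \<xi>_Suc_le:
  assumes "t \<le> T"
  shows "\<xi> (Suc t) \<le> \<xi> t + \<gamma>\<^sup>2 * Lg * G"
proof -
  have "(\<Sum>k = 1..K. dual k (Suc t)) - (\<Sum>k = 1..K. dual k t) \<le> (\<Sum>k = 1..K. \<gamma> * \<bar>g k (x t)\<bar>)"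
    unfolding sum_subtractf[symmetric] by (intro sum_mono) (use abs_dual_diff_le in \<open>auto simp: abs_le_iff simp del: dual.simps\<close>)
  also have "\<dots> \<le> \<gamma> * G"
    using sum_abs_g_le[OF x_in_prob_simplex[OF assms]] \<gamma> by (simp flip: sum_distrib_left)
  finally have "\<gamma> * Lg * ((\<Sum>k = 1..K. dual k (Suc t)) - (\<Sum>k = 1..K. dual k t)) \<le> \<gamma> * Lg * (\<gamma> * G)"
    using \<gamma> constants_nonneg by (intro mult_left_mono) auto
  then show ?thesis
    by (simp add: \<xi>_def power2_eq_square algebra_simps del: dual.simps)
qed

text \<open>
  The curvature constant of round \<open>t\<close> exceeds that of the preceding round by at most
  \<open>\<gamma>\<^sup>2 * Lg * G\<close>, which the definition of \<open>\<alpha> (t - 1)\<close> reserves. In the first round both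
  iterates are the barycentre.
\<close>
lemma curvature_absorbed:
  assumes t: "t \<in> {1..T}"
  shows "3 * (\<xi> t + \<eta> * Lf\<^sup>2) / 2 * (norm (x (t - 1) - xt t))\<^sup>2
    \<le> (\<alpha> (t - 1) / 2 - 1 / \<eta>) * (norm (x (t - 1) - xt t))\<^sup>2"
proof (cases "t = 1")
  case True
  then show ?thesis using run by (simp add: mirror_prox_run_def)
next
  case False
  then have t1: "t - 1 \<in> {1..T}" "Suc (t - 1) = t"
    using t by auto
  have "\<xi> t \<le> \<xi> (t - 1) + \<gamma>\<^sup>2 * Lg * G"
    using \<xi>_Suc_le[of "t - 1"] t1 by simp
  then have "3 * (\<xi> t + \<eta> * Lf\<^sup>2) / 2 \<le> \<alpha> (t - 1) / 2 - 1 / \<eta>"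
    using \<alpha>_ge[OF t1(1)] by simp
  then show ?thesis
    by (rule mult_right_mono) simp
qed

lemma young_steps:
  assumes t: "t \<in> {1..T}"
  shows "(gradient_variation t + Lf * norm (x t - x (t - 1))) * norm (x t - xt (Suc t))
    \<le> \<eta> / 2 * (gradient_variation t)\<^sup>2 + \<eta> * Lf\<^sup>2 / 2 * (norm (x t - x (t - 1)))\<^sup>2
      + 1 / \<eta> * (norm (x t - xt (Suc t)))\<^sup>2"
proof -
  have young: "p * q \<le> \<eta> / 2 * p\<^sup>2 + 1 / (2 * \<eta>) * q\<^sup>2" for p q :: real
  proof -
    have "0 \<le> (\<eta> * p - q)\<^sup>2 / (2 * \<eta>)"
      using \<eta> by simp
    also have "\<dots> = \<eta> / 2 * p\<^sup>2 + 1 / (2 * \<eta>) * q\<^sup>2 - p * q"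
      using \<eta> by (simp add: power2_eq_square field_simps)
    finally show ?thesis by simp
  qed
  show ?thesis
    using young[of "gradient_variation t" "norm (x t - xt (Suc t))"]
      young[of "Lf * norm (x t - x (t - 1))" "norm (x t - xt (Suc t))"]
    by (simp add: power_mult_distrib algebra_simps)
qed

text \<open>
  The path from \<open>x (t - 1)\<close> to \<open>x t\<close> passes through the intermediate iterate and the prox centre, so
  both outer pieces are controlled by divergences of the two prox steps.
\<close>
lemma movement_le:
  assumes t: "t \<in> {1..T}"
  shows "(norm (x t - x (t - 1)))\<^sup>2
    \<le> 3 * (norm (x t - centre t))\<^sup>2 + 3 * (norm (x (t - 1) - xt t))\<^sup>2 + 12 * \<nu>\<^sup>2"
proof -
  define p q r where "p = norm (x t - centre t)" and "q = norm (x (t - 1) - xt t)" and "r = norm (xt t - centre t)"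
  have "x t - x (t - 1) = (x t - centre t) - (x (t - 1) - xt t) - (xt t - centre t)"
    by simp
  then have "norm (x t - x (t - 1)) \<le> p + q + r"
    using norm_triangle_ineq4[of "(x t - centre t) - (x (t - 1) - xt t)" "xt t - centre t"]
      norm_triangle_ineq4[of "x t - centre t" "x (t - 1) - xt t"]
    by (simp add: p_def q_def r_def)
  moreover have "r \<le> 2 * \<nu>"
    unfolding r_def using norm_xt_centre_le t by auto
  ultimately have "norm (x t - x (t - 1)) \<le> p + q + 2 * \<nu>"
    by simp
  then have "(norm (x t - x (t - 1)))\<^sup>2 \<le> (p + q + 2 * \<nu>)\<^sup>2"
    by (intro power_mono) auto
  also have "\<dots> \<le> 3 * p\<^sup>2 + 3 * q\<^sup>2 + 3 * (2 * \<nu>)\<^sup>2"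
  proof -
    have "0 \<le> (p - q)\<^sup>2 + (p - 2 * \<nu>)\<^sup>2 + (q - 2 * \<nu>)\<^sup>2"
      by simp
    then show ?thesis by (simp add: power2_eq_square algebra_simps)
  qed
  finally show ?thesis
    by (simp add: p_def q_def power_mult_distrib)
qed

text \<open>
  Each error is charged to a part of \<open>\<alpha> t\<close> or of the potential: the change of the loss gradient, by
  Young's inequality, to the leftover divergence of round \<open>t\<close> (the term \<open>2 / \<eta>\<close>), and the
  movement to the divergence from the prox centre and to the potential (the factors \<open>3\<close>).
\<close>
lemma one_round:
  assumes t: "t \<in> {1..T}" and z: "z \<in> prob_simplex d"
  shows "dot d (df t (x t)) (x t - z) + (potential (Suc t) - potential t)
    \<le> \<gamma> * (\<Sum>k = 1..K. weight k t * g k z) + \<eta> / 2 * (gradient_variation t)\<^sup>2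
      + \<alpha> t * (KL d z (centre t) - KL d z (centre (Suc t))) + 4 * \<nu> * \<alpha> t"
proof -
  define a b c a0 e where "a = norm (x t - xt (Suc t))" and "b = norm (x t - x (t - 1))"
    and "c = norm (x t - centre t)" and "a0 = norm (x (t - 1) - xt t)" and "e = \<xi> t + \<eta> * Lf\<^sup>2"
  have \<alpha>: "0 < \<alpha> t"
    by (rule \<alpha>_pos[OF t])
  have e: "0 \<le> e" "3 * e \<le> \<alpha> t"
  proof -
    show "0 \<le> e"
      using \<xi>_nonneg[of t] \<eta> by (simp add: e_def)
    have "0 \<le> 3 * (\<gamma>\<^sup>2 * Lg * G) + 2 / \<eta>"
      using \<eta> constants_nonneg by (intro add_nonneg_nonneg mult_nonneg_nonneg) auto
    then show "3 * e \<le> \<alpha> t"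
      using \<alpha>_ge[OF t] by (simp add: e_def algebra_simps)
  qed
  have "\<xi> t / 2 * b\<^sup>2 + \<eta> * Lf\<^sup>2 / 2 * b\<^sup>2 = e / 2 * b\<^sup>2"
    by (simp add: e_def field_simps)
  also have "\<dots> \<le> e / 2 * (3 * c\<^sup>2 + 3 * a0\<^sup>2 + 12 * \<nu>\<^sup>2)"
    unfolding b_def c_def a0_def using movement_le[OF t] e by (intro mult_left_mono) auto
  also have "\<dots> = 3 * e * c\<^sup>2 / 2 + 3 * e / 2 * a0\<^sup>2 + 2 * (3 * e * \<nu>\<^sup>2)"
    by (simp add: field_simps)
  finally have "\<xi> t / 2 * b\<^sup>2 + \<eta> * Lf\<^sup>2 / 2 * b\<^sup>2
      \<le> 3 * e * c\<^sup>2 / 2 + 3 * e / 2 * a0\<^sup>2 + 2 * (3 * e * \<nu>\<^sup>2)" .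
  moreover have "3 * e * c\<^sup>2 \<le> \<alpha> t * c\<^sup>2"
    using e by (intro mult_right_mono) auto
  moreover have "3 * e * \<nu>\<^sup>2 \<le> \<alpha> t * \<nu>"
    using \<nu> e \<alpha> mult_right_mono[of \<nu> 1 \<nu>]
    by (intro mult_mono) (auto simp: power2_eq_square)
  moreover have "4 * \<nu> * \<alpha> t = 2 * (\<alpha> t * \<nu>) + \<alpha> t * (2 * \<nu>)"
    by simp
  moreover have "3 * e / 2 * a0\<^sup>2 \<le> (\<alpha> (t - 1) / 2 - 1 / \<eta>) * a0\<^sup>2"
    unfolding e_def a0_def by (rule curvature_absorbed[OF t])
  moreover have "\<alpha> t * KL d z (centre (Suc t)) \<le> \<alpha> t * (KL d z (xt (Suc t)) + 2 * \<nu>)"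
    using KL_centre_le_KL_xt[OF _ z, of "Suc t"] t \<alpha> by (intro mult_left_mono) auto
  moreover have "potential (Suc t) = (\<Sum>k = 1..K. (dual k (Suc t))\<^sup>2) / 2
      - \<gamma>\<^sup>2 / 2 * (\<Sum>k = 1..K. (g k (x t))\<^sup>2) + (\<alpha> t / 2 - 1 / \<eta>) * a\<^sup>2"
    by (simp add: potential_def a_def del: dual.simps)
  moreover have "potential t = (\<Sum>k = 1..K. (dual k t)\<^sup>2) / 2
      - \<gamma>\<^sup>2 / 2 * (\<Sum>k = 1..K. (g k (x (t - 1)))\<^sup>2) + (\<alpha> (t - 1) / 2 - 1 / \<eta>) * a0\<^sup>2"
    by (simp add: potential_def a0_def)
  moreover note prox_pair_inequality[OF t z] young_steps[OF t] penalty_inequality[OF t z]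
  ultimately show ?thesis
    unfolding a_def[symmetric] b_def[symmetric] c_def[symmetric]
      left_diff_distrib right_diff_distrib distrib_left by linarith
qed

text \<open>
  The analysis is summed over an arbitrary window of rounds: all rounds give the regret, and a short
  window gives the bound on the dual iterates.
\<close>
lemma window_inequality:
  assumes mn: "1 \<le> m" "m \<le> n" "n \<le> T" and z: "z \<in> prob_simplex d"
  shows "(\<Sum>t = m..n. dot d (df t (x t)) (x t - z)) + potential (Suc n) - potential m
    \<le> \<gamma> * (\<Sum>t = m..n. \<Sum>k = 1..K. weight k t * g k z) + \<eta> / 2 * (\<Sum>t = m..n. (gradient_variation t)\<^sup>2)
      + \<alpha> n * (ln (real d / \<nu>) + 4 * \<nu> * real T)"
proof -
  have "(\<Sum>t = m..n. dot d (df t (x t)) (x t - z)) + (\<Sum>t = m..n. potential (Suc t) - potential t)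
    \<le> (\<Sum>t = m..n. \<gamma> * (\<Sum>k = 1..K. weight k t * g k z) + \<eta> / 2 * (gradient_variation t)\<^sup>2
      + \<alpha> t * (KL d z (centre t) - KL d z (centre (Suc t))) + 4 * \<nu> * \<alpha> t)"
    unfolding sum.distrib[symmetric] using mn by (intro sum_mono one_round z) auto
  moreover have "(\<Sum>t = m..n. \<gamma> * (\<Sum>k = 1..K. weight k t * g k z) + \<eta> / 2 * (gradient_variation t)\<^sup>2
      + \<alpha> t * (KL d z (centre t) - KL d z (centre (Suc t))) + 4 * \<nu> * \<alpha> t)
    = \<gamma> * (\<Sum>t = m..n. \<Sum>k = 1..K. weight k t * g k z) + \<eta> / 2 * (\<Sum>t = m..n. (gradient_variation t)\<^sup>2)
      + (\<Sum>t = m..n. \<alpha> t * (KL d z (centre t) - KL d z (centre (Suc t)))) + (\<Sum>t = m..n. 4 * \<nu> * \<alpha> t)"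
    by (simp add: sum.distrib sum_distrib_left)
  moreover have "(\<Sum>t = m..n. potential (Suc t) - potential t) = potential (Suc n) - potential m"
    using mn by (intro sum_Suc_diff) auto
  moreover have "(\<Sum>t = m..n. \<alpha> t * (KL d z (centre t) - KL d z (centre (Suc t))))
      \<le> \<alpha> n * (ln (real d / \<nu>) - KL d z (centre (Suc n)))"
    using mn less_imp_le[OF \<alpha>_pos(2)]
    by (intro sum_stepsize_telescope_le \<alpha>_mono KL_centre_le z) auto
  moreover have "\<alpha> n * (ln (real d / \<nu>) - KL d z (centre (Suc n))) \<le> \<alpha> n * ln (real d / \<nu>)"
    using KL_centre_nonneg[OF _ z, of "Suc n"] less_imp_le[OF \<alpha>_pos(2)[of n]] mn by (intro mult_left_mono) auto
  moreover have "(\<Sum>t = m..n. 4 * \<nu> * \<alpha> t) \<le> \<alpha> n * (4 * \<nu> * real T)"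
  proof -
    have "(\<Sum>t = m..n. 4 * \<nu> * \<alpha> t) \<le> (\<Sum>t = m..n. 4 * \<nu> * \<alpha> n)"
      using mn \<nu> by (intro sum_mono mult_left_mono \<alpha>_mono) auto
    also have "\<dots> = real (Suc n - m) * (4 * \<nu> * \<alpha> n)"
      by simp
    also have "\<dots> \<le> real T * (4 * \<nu> * \<alpha> n)"
      using mn \<nu> less_imp_le[OF \<alpha>_pos(2)[of n]] by (intro mult_right_mono) auto
    finally show ?thesis by (simp add: mult_ac)
  qed
  ultimately show ?thesis
    unfolding distrib_left[of "\<alpha> n"] by linarith
qed

lemma sum_g_power2_le: "u \<in> prob_simplex d \<Longrightarrow> (\<Sum>k = 1..K. (g k u)\<^sup>2) \<le> G\<^sup>2"
proof -
  assume u: "u \<in> prob_simplex d"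
  have "(\<Sum>k = 1..K. (g k u)\<^sup>2) \<le> (\<Sum>k = 1..K. \<bar>g k u\<bar> * G)"
  proof (intro sum_mono)
    fix k assume "k \<in> {1..K}"
    then have "\<bar>g k u\<bar> \<le> (\<Sum>k = 1..K. \<bar>g k u\<bar>)"
      by (intro member_le_sum) auto
    then have "\<bar>g k u\<bar> \<le> G"
      using sum_abs_g_le[OF u] by simp
    then have "\<bar>g k u\<bar> * \<bar>g k u\<bar> \<le> \<bar>g k u\<bar> * G"
      by (intro mult_left_mono) auto
    then show "(g k u)\<^sup>2 \<le> \<bar>g k u\<bar> * G"
      by (simp add: power2_eq_square)
  qed
  also have "\<dots> \<le> G * G"
    unfolding sum_distrib_right[symmetric] using sum_abs_g_le[OF u] constants_nonneg
    by (intro mult_right_mono) auto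
  finally show ?thesis by (simp add: power2_eq_square)
qed

lemma potential_1: "potential 1 = 0"
proof -
  \<comment> \<open>Started from \<open>dual k 0 = 0\<close>, the first dual update gives exactly \<open>\<gamma> * \<bar>g k (x 0)\<bar>\<close>.\<close>
  have "x 0 = xt 1"
    using run by (simp add: mirror_prox_run_def)
  moreover have "(dual k 1)\<^sup>2 = \<gamma>\<^sup>2 * (g k (x 0))\<^sup>2" for k
    using \<gamma> by (simp add: max_def power_mult_distrib)
  ultimately show ?thesis
    by (simp add: potential_def flip: sum_distrib_left)
qed

lemma potential_Suc_nonneg:
  assumes "t \<in> {1..T}"
  shows "0 \<le> potential (Suc t)"
proof -
  have "\<gamma>\<^sup>2 * (g k (x t))\<^sup>2 \<le> (dual k (Suc t))\<^sup>2" for k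
    using power_mono[OF abs_g_le_dual[of k t], of 2] \<gamma> by (simp add: power_mult_distrib del: dual.simps)
  then have "(\<Sum>k = 1..K. \<gamma>\<^sup>2 * (g k (x t))\<^sup>2) \<le> (\<Sum>k = 1..K. (dual k (Suc t))\<^sup>2)"
    by (rule sum_mono)
  moreover have "0 \<le> (\<alpha> t / 2 - 1 / \<eta>) * (norm (x t - xt (Suc t)))\<^sup>2"
    using \<alpha>_pos[OF assms] by (intro mult_nonneg_nonneg) auto
  ultimately show ?thesis
    by (simp add: potential_def del: dual.simps flip: sum_distrib_left)
qed

lemma potential_Suc_ge:
  assumes "t \<in> {1..T}"
  shows "(\<Sum>k = 1..K. (dual k (Suc t))\<^sup>2) / 2 - \<gamma>\<^sup>2 / 2 * G\<^sup>2 \<le> potential (Suc t)"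
proof -
  have "\<gamma>\<^sup>2 / 2 * (\<Sum>k = 1..K. (g k (x t))\<^sup>2) \<le> \<gamma>\<^sup>2 / 2 * G\<^sup>2"
    using assms by (intro mult_left_mono sum_g_power2_le x_in_prob_simplex) auto
  moreover have "0 \<le> (\<alpha> t / 2 - 1 / \<eta>) * (norm (x t - xt (Suc t)))\<^sup>2"
    using \<alpha>_pos[OF assms] by (intro mult_nonneg_nonneg) auto
  ultimately show ?thesis
    by (simp add: potential_def del: dual.simps)
qed

lemma potential_le:
  assumes "t \<in> {1..T}"
  shows "potential t \<le> (\<Sum>k = 1..K. (dual k t)\<^sup>2) / 2 + 2 * \<alpha> t"
proof -
  have a: "0 \<le> \<alpha> (t - 1)" "\<alpha> (t - 1) \<le> \<alpha> t"
    using \<alpha>_mono[of 0 "t - 1"] \<alpha>_mono[of "t - 1" t] \<alpha>_0 assms by auto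
  have "(norm (x (t - 1) - xt t))\<^sup>2 \<le> 2\<^sup>2"
    using assms by (intro power_mono norm_diff_prob_simplex_le[of _ d] x_in_prob_simplex xt_in_prob_simplex) auto
  then have "\<alpha> (t - 1) / 2 * (norm (x (t - 1) - xt t))\<^sup>2 \<le> \<alpha> t / 2 * 4"
    using a by (intro mult_mono) auto
  moreover have "0 \<le> 1 / \<eta> * (norm (x (t - 1) - xt t))\<^sup>2"
    using \<eta> by simp
  moreover have "0 \<le> \<gamma>\<^sup>2 / 2 * (\<Sum>k = 1..K. (g k (x (t - 1)))\<^sup>2)"
    by (intro mult_nonneg_nonneg sum_nonneg) auto
  ultimately show ?thesis
    unfolding potential_def left_diff_distrib by linarith
qed

end

section \<open>Bounds on the dual iterates and on the regret\<close>

text \<open>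
  In the four polynomials below \<open>s\<close> stands for the inverse of the Slater constant. The window that
  bounds the dual iterates has length at most \<open>window_const * M\<close>, the step parameters are at most
  \<open>\<gamma>\<^sup>2 * (step_const + 3 * Lg * R)\<close> when the dual 1-norms are at most \<open>\<gamma> * R\<close>, and the Euclidean
  norm of the dual iterates is at most \<open>\<gamma> * dual_const * M\<close>. Here \<open>M\<close> is the logarithmic
  factor, up to an additive constant.
\<close>
definition window_const :: "real \<Rightarrow> real \<Rightarrow> real \<Rightarrow> real" where
  "window_const Lg K s = (3 * Lg * K + 1) * s + 1"

definition step_const :: "real \<Rightarrow> real \<Rightarrow> real \<Rightarrow> real" where
  "step_const H G Lg = 5 + 6 * Lg * G + 3 * H\<^sup>2"

definition dual_const :: "real \<Rightarrow> real \<Rightarrow> real \<Rightarrow> real \<Rightarrow> real \<Rightarrow> real \<Rightarrow> real" where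
  "dual_const H F G Lg K s =
     G\<^sup>2 * window_const Lg K s * (window_const Lg K s + 1) + G * window_const Lg K s
     + 2 * F * window_const Lg K s + G\<^sup>2 + 1 + step_const H G Lg"

definition regret_const :: "real \<Rightarrow> real \<Rightarrow> real \<Rightarrow> real \<Rightarrow> real \<Rightarrow> real \<Rightarrow> real" where
  "regret_const H F G Lg K s = step_const H G Lg + 3 * Lg * K * dual_const H F G Lg K s + 1"

text \<open>
  Only these consequences of the choice of \<open>\<eta>\<close>, \<open>\<gamma>\<close>, \<open>\<nu>\<close> enter the analysis. The constant \<open>6\<close> in
  \<open>M\<close> leaves space for \<open>4 * \<nu> * T = 4\<close>, the total cost of mixing, and for the \<open>2 * \<alpha> n\<close> with which a
  window may start.
\<close>
locale tuned_mirror_prox = mirror_prox +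
  fixes M :: real
  assumes T_pos: "1 \<le> T" and \<nu>_eq: "\<nu> = 1 / real T" and \<eta>_\<gamma>: "\<eta> * \<gamma>\<^sup>2 = 1" and \<gamma>_ge_1: "1 \<le> \<gamma>\<^sup>2"
    and \<eta>_Lf: "\<eta> * Lf\<^sup>2 \<le> \<gamma>\<^sup>2"
    and \<eta>_variation: "\<eta> * (\<Sum>t = 1..T. (gradient_variation t)\<^sup>2) \<le> \<gamma>\<^sup>2"
    and M: "M = ln (real d / \<nu>) + 6"
begin

lemma M_ge_1: "1 \<le> M"
proof -
  have "1 * 1 \<le> real T * real d"
    using T_pos d by (intro mult_mono) auto
  then have "0 \<le> ln (real T * real d)"
    by simp
  then show ?thesis by (simp add: M \<nu>_eq mult.commute)
qed

lemma tuned_window_inequality: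
  assumes mn: "1 \<le> m" "m \<le> n" "n \<le> T" and z: "z \<in> prob_simplex d"
  shows "(\<Sum>t = m..n. dot d (df t (x t)) (x t - z)) + potential (Suc n) - potential m
    \<le> \<gamma> * (\<Sum>t = m..n. \<Sum>k = 1..K. weight k t * g k z) + \<gamma>\<^sup>2 / 2 + \<alpha> n * (M - 2)"
proof -
  have "(\<Sum>t = m..n. (gradient_variation t)\<^sup>2) \<le> (\<Sum>t = 1..T. (gradient_variation t)\<^sup>2)"
    using mn by (intro sum_mono2) auto
  then have "\<eta> * (\<Sum>t = m..n. (gradient_variation t)\<^sup>2) \<le> \<gamma>\<^sup>2"
    using \<eta>_variation \<eta> by (meson mult_left_mono less_imp_le order_trans)
  then show ?thesis
    using window_inequality[OF mn z] T_pos by (simp add: M \<nu>_eq add.commute)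
qed

lemma \<alpha>_le:
  assumes "0 \<le> R" "\<And>t. 1 \<le> t \<Longrightarrow> t \<le> n \<Longrightarrow> (\<Sum>k = 1..K. dual k t) \<le> \<gamma> * R" "n \<le> T"
  shows "\<alpha> n \<le> \<gamma>\<^sup>2 * (step_const H G Lg + 3 * Lg * R)"
  using assms(2,3)
proof (induction n)
  case 0
  have "0 \<le> \<gamma>\<^sup>2 * (step_const H G Lg + 3 * Lg * R)"
    using constants_nonneg assms(1) by (auto simp: step_const_def intro!: mult_nonneg_nonneg add_nonneg_nonneg)
  then show ?case by (simp add: \<alpha>_0)
next
  case (Suc n)
  have "\<gamma> * Lg * (\<Sum>k = 1..K. dual k (Suc n)) \<le> \<gamma> * Lg * (\<gamma> * R)"
    using Suc.prems(1)[of "Suc n"] \<gamma> constants_nonneg by (intro mult_left_mono) (auto simp del: dual.simps)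
  moreover have "2 / \<eta> = 2 * \<gamma>\<^sup>2"
    using \<eta>_\<gamma> \<eta> by (simp add: field_simps)
  ultimately have "3 * (\<eta> * Lf\<^sup>2 + \<gamma>\<^sup>2 * Lg * G) + 2 / \<eta> + 3 * \<xi> (Suc n) \<le> \<gamma>\<^sup>2 * (step_const H G Lg + 3 * Lg * R)"
    using \<eta>_Lf by (simp add: \<xi>_def step_const_def power2_eq_square algebra_simps del: dual.simps)
  then show ?case
    using Suc.IH Suc.prems \<alpha>_eq[of "Suc n"] by simp
qed

lemma sum_dual_diff_le:
  assumes "m \<le> n" "n \<le> T"
  shows "(\<Sum>k = 1..K. dual k n) \<le> (\<Sum>k = 1..K. dual k m) + real (n - m) * (\<gamma> * G)"
  using assms
proof (induction n rule: dec_induct)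
  case (step n)
  have "(\<Sum>k = 1..K. dual k (Suc n)) \<le> (\<Sum>k = 1..K. dual k n + \<gamma> * \<bar>g k (x n)\<bar>)"
    using abs_dual_diff_le by (intro sum_mono) (simp add: abs_le_iff algebra_simps del: dual.simps)
  moreover have "\<gamma> * (\<Sum>k = 1..K. \<bar>g k (x n)\<bar>) \<le> \<gamma> * G"
    using step.prems \<gamma> by (intro mult_left_mono sum_abs_g_le x_in_prob_simplex) auto
  ultimately show ?case
    using step.IH step.prems step.hyps
    by (simp add: sum.distrib Suc_diff_le algebra_simps sum_distrib_left del: dual.simps)
qed simp

text \<open>
  Comparing with a Slater point turns the penalty into a gain proportional to the dual iterates. If
  the dual norm does not shrink over the window, this gain is at most the total of all errors.
\<close>
lemma dual_window_bound:
  assumes mn: "1 \<le> m" "m \<le> n" "n \<le> T" and z: "z \<in> prob_simplex d"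
    and slater: "\<And>k. k \<in> {1..K} \<Longrightarrow> g k z \<le> - \<sigma>" and \<sigma>: "0 < \<sigma>"
    and grow: "(\<Sum>k = 1..K. (dual k m)\<^sup>2) \<le> (\<Sum>k = 1..K. (dual k (Suc n))\<^sup>2)"
  shows "\<gamma> * \<sigma> * (\<Sum>t = m..n. \<Sum>k = 1..K. weight k t)
    \<le> 2 * F * real (Suc n - m) + \<gamma>\<^sup>2 * (G\<^sup>2 + 1) / 2 + \<alpha> n * M"
proof -
  have "- (2 * F * real (Suc n - m)) = (\<Sum>t = m..n. - (F * 2))"
    using mn by simp
  also have "\<dots> \<le> (\<Sum>t = m..n. dot d (df t (x t)) (x t - z))"
  proof (rule sum_mono)
    fix t assume "t \<in> {m..n}"
    then have xt: "x t \<in> prob_simplex d"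
      using mn by (intro x_in_prob_simplex) auto
    have "\<bar>dot d (df t (x t)) (x t - z)\<bar> \<le> norm_inf d (df t (x t)) * norm (x t - z)"
      using xt z by (intro abs_dot_le Rd_diff prob_simplexD(1))
    also have "\<dots> \<le> F * 2"
      using norm_inf_df_le[OF xt] norm_diff_prob_simplex_le[OF xt z] constants_nonneg
      by (intro mult_mono) auto
    finally show "- (F * 2) \<le> dot d (df t (x t)) (x t - z)"
      by linarith
  qed
  finally have loss: "- (2 * F * real (Suc n - m)) \<le> (\<Sum>t = m..n. dot d (df t (x t)) (x t - z))" .
  have "(\<Sum>t = m..n. \<Sum>k = 1..K. weight k t * g k z) \<le> (\<Sum>t = m..n. \<Sum>k = 1..K. weight k t * (- \<sigma>))"
    using weight_nonneg slater mn by (intro sum_mono mult_left_mono) auto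
  also have "\<dots> = - (\<sigma> * (\<Sum>t = m..n. \<Sum>k = 1..K. weight k t))"
    by (simp add: sum_distrib_left sum_negf mult.commute)
  finally have "\<gamma> * (\<Sum>t = m..n. \<Sum>k = 1..K. weight k t * g k z)
      \<le> \<gamma> * - (\<sigma> * (\<Sum>t = m..n. \<Sum>k = 1..K. weight k t))"
    using \<gamma> by (intro mult_left_mono) auto
  then have penalty: "\<gamma> * (\<Sum>t = m..n. \<Sum>k = 1..K. weight k t * g k z)
      \<le> - (\<gamma> * \<sigma> * (\<Sum>t = m..n. \<Sum>k = 1..K. weight k t))"
    by simp
  have "\<alpha> m \<le> \<alpha> n" "m \<in> {1..T}" "n \<in> {1..T}"
    using mn by (auto intro: \<alpha>_mono)
  then have "- (\<gamma>\<^sup>2 / 2 * G\<^sup>2) - 2 * \<alpha> n \<le> potential (Suc n) - potential m"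
    using potential_le[of m] potential_Suc_ge[of n] grow by (simp del: dual.simps)
  with loss penalty tuned_window_inequality[OF mn z] show ?thesis
    by (simp add: algebra_simps add_divide_distrib)
qed

text \<open>
  The step parameters grow with the dual iterates, so the error of a single round cannot be balanced
  against the gain of that round. Consider instead a window that ends at the maximal dual norm
  \<open>\<gamma> * r\<close>, and measure in units of \<open>\<gamma>\<^sup>2\<close>. The step parameters enter only once, with a cost of
  about \<open>3 * Lg * K * r * M\<close>, whereas the gain is about \<open>\<sigma> * r\<close> in each round, because the dual
  iterates move by at most \<open>\<gamma> * G\<close> per round.
  A window of length \<open>(3 * Lg * K + 1) * M / \<sigma>\<close> makes the gain exceed this cost by \<open>M * r\<close>, and
  the remaining errors are at most quadratic in \<open>M\<close>. If the maximum occurs too early for such a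
  window, the dual iterates are small because few rounds have passed.
\<close>
lemma dual_bound:
  assumes slater: "slater d K g \<sigma>" and t: "t \<le> T"
  shows "(\<Sum>k = 1..K. dual k t) \<le> \<gamma> * (real K * (dual_const H F G Lg (real K) (1 / \<sigma>) * M))"
proof (cases "K = 0")
  case False
  define c where "c = window_const Lg (real K) (1 / \<sigma>)"
  define B where "B = step_const H G Lg"
  define E where "E = dual_const H F G Lg (real K) (1 / \<sigma>)"
  obtain z where z: "z \<in> prob_simplex d" and gz: "\<And>k. k \<in> {1..K} \<Longrightarrow> g k z \<le> - \<sigma>" and \<sigma>: "0 < \<sigma>"
    using slater by (auto simp: slater_def)
  \<comment> \<open>\<open>\<sigma>\<close> itself must be bounded, as the final constant may contain only \<open>1 / \<sigma>\<close>.\<close>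
  have "\<bar>g 1 z\<bar> \<le> (\<Sum>k = 1..K. \<bar>g k z\<bar>)"
    using False by (intro member_le_sum) auto
  then have \<sigma>_le_G: "\<sigma> \<le> G"
    using gz[of 1] sum_abs_g_le[OF z] False by simp
  note nonneg = constants_nonneg(1-4)
  have c: "1 \<le> c"
    using nonneg \<sigma> by (simp add: c_def window_const_def)
  have B: "0 \<le> B"
    using nonneg by (simp add: B_def step_const_def)
  have E: "E = G\<^sup>2 * c * (c + 1) + G * c + 2 * F * c + G\<^sup>2 + 1 + B"
    by (simp add: E_def dual_const_def c_def B_def)
  define S where "S t = (\<Sum>k = 1..K. (dual k t)\<^sup>2)" for t
  have "Max (S ` {..T}) \<in> S ` {..T}"
    by (intro Max_in) auto
  then obtain N where N: "N \<le> T" "S N = Max (S ` {..T})"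
    by (metis atMost_iff imageE)
  then have S_le: "S t \<le> S N" if "t \<le> T" for t
    using that by simp
  define r where "r = sqrt (S N) / \<gamma>"
  have sqrt_S: "sqrt (S N) = \<gamma> * r"
    using \<gamma> by (simp add: r_def)
  have r: "0 \<le> r"
    using \<gamma> by (simp add: r_def S_def sum_nonneg)
  have sum_dual_le: "(\<Sum>k = 1..K. dual k t) \<le> \<gamma> * (real K * r)" if "t \<le> T" for t
  proof -
    have "dual k t \<le> \<gamma> * r" if k: "k \<in> {1..K}" for k
    proof -
      have "(dual k t)\<^sup>2 \<le> S t"
        unfolding S_def using k by (intro member_le_sum) auto
      then have "dual k t \<le> sqrt (S N)"
        using S_le[OF \<open>t \<le> T\<close>] by (intro real_le_rsqrt) simp
      then show ?thesis by (simp add: sqrt_S)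
    qed
    then have "(\<Sum>k = 1..K. dual k t) \<le> (\<Sum>k = 1..K. \<gamma> * r)"
      by (rule sum_mono)
    then show ?thesis by (simp add: mult_ac)
  qed
  have r_le: "\<gamma> * r \<le> (\<Sum>k = 1..K. dual k N)"
    using L2_set_le_sum[of "{1..K}" "\<lambda>k. dual k N"] dual_nonneg
    by (simp add: L2_set_def sqrt_S[symmetric] S_def)
  define \<tau> where "\<tau> = nat \<lceil>(3 * Lg * real K + 1) * M / \<sigma>\<rceil>"
  have pos: "0 < (3 * Lg * real K + 1) * M / \<sigma>"
    using nonneg \<sigma> M_ge_1 by (intro divide_pos_pos mult_pos_pos add_nonneg_pos) auto
  have \<tau>_ge: "(3 * Lg * real K + 1) * M / \<sigma> \<le> real \<tau>"
    unfolding \<tau>_def by (rule real_nat_ceiling_ge)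
  have "real \<tau> \<le> (3 * Lg * real K + 1) * M / \<sigma> + 1"
    unfolding \<tau>_def using pos by linarith
  then have \<tau>_le: "real \<tau> \<le> c * M"
    using M_ge_1 by (simp add: c_def window_const_def algebra_simps add_divide_distrib)
  have \<tau>_pos: "1 \<le> \<tau>"
    using pos \<tau>_ge by linarith
  have "r \<le> E * M"
  proof (cases "N \<le> \<tau>")
    case True
    have "\<gamma> * r \<le> real N * (\<gamma> * G)"
      using r_le sum_dual_diff_le[of 0 N] N by simp
    also have "\<dots> \<le> (c * M) * (\<gamma> * G)"
      using True \<tau>_le \<gamma> nonneg by (intro mult_right_mono) auto
    finally have "\<gamma> * r \<le> \<gamma> * ((G * c) * M)"
      by (simp add: mult_ac)
    then have "r \<le> (G * c) * M"
      using \<gamma> by simp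
    also have "\<dots> \<le> E * M"
      unfolding E using nonneg c B M_ge_1 by (intro mult_right_mono) auto
    finally show ?thesis .
  next
    case False
    define m n where "m = N - \<tau>" and "n = N - 1"
    have mn: "1 \<le> m" "m \<le> n" "n \<le> T" "Suc n = N" "Suc n - m = \<tau>"
      using False \<tau>_pos N by (auto simp: m_def n_def)
    have rounds: "\<gamma> * (r - G * (real \<tau> + 1)) \<le> (\<Sum>k = 1..K. weight k t)" if "t \<in> {m..n}" for t
    proof -
      have t: "1 \<le> t" "t \<le> T" "t \<le> N" "real (N - t) \<le> real \<tau>"
        using that mn N by auto
      have "real (N - t) * (\<gamma> * G) \<le> real \<tau> * (\<gamma> * G)"
        using t \<gamma> nonneg by (intro mult_right_mono) auto
      then show ?thesis
        using r_le sum_dual_diff_le[OF t(3) N(1)] sum_weight_bounds(2)[OF t(1,2)]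
        by (simp add: algebra_simps)
    qed
    have "(\<Sum>t = m..n. \<gamma> * (r - G * (real \<tau> + 1))) \<le> (\<Sum>t = m..n. \<Sum>k = 1..K. weight k t)"
      by (intro sum_mono rounds)
    then have "real \<tau> * (\<gamma> * (r - G * (real \<tau> + 1))) \<le> (\<Sum>t = m..n. \<Sum>k = 1..K. weight k t)"
      by (simp only: sum_constant card_atLeastAtMost mn(5))
    then have "\<gamma> * \<sigma> * (real \<tau> * (\<gamma> * (r - G * (real \<tau> + 1)))) \<le> \<gamma> * \<sigma> * (\<Sum>t = m..n. \<Sum>k = 1..K. weight k t)"
      using \<gamma> \<sigma> by (intro mult_left_mono) auto
    also have "\<dots> \<le> 2 * F * real \<tau> + \<gamma>\<^sup>2 * (G\<^sup>2 + 1) / 2 + \<alpha> n * M"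
    proof -
      have "m \<le> T"
        using mn by simp
      then have "(\<Sum>k = 1..K. (dual k m)\<^sup>2) \<le> (\<Sum>k = 1..K. (dual k (Suc n))\<^sup>2)"
        using S_le[of m] unfolding S_def mn(4) by blast
      from dual_window_bound[OF mn(1-3) z gz \<sigma> this] show ?thesis
        unfolding mn(5) .
    qed
    also have "\<dots> \<le> \<gamma>\<^sup>2 * (2 * F * real \<tau>) + \<gamma>\<^sup>2 * (G\<^sup>2 + 1) / 2 + \<gamma>\<^sup>2 * (B + 3 * Lg * (real K * r)) * M"
    proof (intro add_mono order_refl mult_right_mono)
      show "2 * F * real \<tau> \<le> \<gamma>\<^sup>2 * (2 * F * real \<tau>)"
        using mult_right_mono[OF \<gamma>_ge_1, of "2 * F * real \<tau>"] nonneg by simp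
      show "\<alpha> n \<le> \<gamma>\<^sup>2 * (B + 3 * Lg * (real K * r))"
        unfolding B_def using r mn by (intro \<alpha>_le sum_dual_le) auto
    qed (use M_ge_1 in simp)
    finally have "\<gamma>\<^sup>2 * (\<sigma> * real \<tau> * r)
        \<le> \<gamma>\<^sup>2 * (\<sigma> * real \<tau> * (G * (real \<tau> + 1)) + 2 * F * real \<tau> + (G\<^sup>2 + 1) / 2 + (B + 3 * Lg * (real K * r)) * M)"
      by (simp add: power2_eq_square algebra_simps add_divide_distrib)
    then have main: "\<sigma> * real \<tau> * r
        \<le> \<sigma> * real \<tau> * (G * (real \<tau> + 1)) + 2 * F * real \<tau> + (G\<^sup>2 + 1) / 2 + (B + 3 * Lg * (real K * r)) * M"
      using \<gamma> by simp
    have "(3 * Lg * real K + 1) * M * r \<le> \<sigma> * real \<tau> * r"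
      using \<tau>_ge \<sigma> r by (intro mult_right_mono) (simp_all add: field_simps)
    with main have "M * r \<le> \<sigma> * real \<tau> * (G * (real \<tau> + 1)) + 2 * F * real \<tau> + (G\<^sup>2 + 1) / 2 + B * M"
      by (simp add: algebra_simps)
    also have "\<dots> \<le> G * (c * M) * (G * ((c + 1) * M)) + 2 * F * (c * M) + (G\<^sup>2 + 1) * M + B * M"
    proof (intro add_mono mult_mono order_refl)
      show "real \<tau> + 1 \<le> (c + 1) * M"
        using \<tau>_le M_ge_1 by (simp add: algebra_simps)
      have "(G\<^sup>2 + 1) / 2 \<le> (G\<^sup>2 + 1) * 1"
        by simp
      also have "\<dots> \<le> (G\<^sup>2 + 1) * M"
        using M_ge_1 by (intro mult_left_mono) auto
      finally show "(G\<^sup>2 + 1) / 2 \<le> (G\<^sup>2 + 1) * M" .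
    qed (use nonneg \<sigma>_le_G \<sigma> \<tau>_le c B M_ge_1 in auto)
    also have "\<dots> \<le> M * (E * M)"
    proof -
      have "(2 * F * c + (G\<^sup>2 + 1) + B) * 1 \<le> (2 * F * c + (G\<^sup>2 + 1) + B) * M"
        using nonneg c B M_ge_1 by (intro mult_left_mono) auto
      moreover have "0 \<le> G * c * M"
        using nonneg c M_ge_1 by simp
      ultimately have "G\<^sup>2 * c * (c + 1) * M + (2 * F * c + (G\<^sup>2 + 1) + B) \<le> E * M"
        unfolding E by (simp add: algebra_simps)
      then have "M * (G\<^sup>2 * c * (c + 1) * M + (2 * F * c + (G\<^sup>2 + 1) + B)) \<le> M * (E * M)"
        using M_ge_1 by (intro mult_left_mono) auto
      then show ?thesis
        by (simp add: power2_eq_square algebra_simps)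
    qed
    finally show ?thesis
      using M_ge_1 by simp
  qed
  then have "\<gamma> * (real K * r) \<le> \<gamma> * (real K * (E * M))"
    using \<gamma> by (intro mult_left_mono) auto
  then show ?thesis
    using sum_dual_le[OF t] by (simp add: E_def)
qed simp

lemma regret_bound:
  assumes slater: "slater d K g \<sigma>" and z: "z \<in> feasible d K g"
  shows "regret T f x z \<le> \<gamma>\<^sup>2 * (regret_const H F G Lg (real K) (1 / \<sigma>) * M\<^sup>2)"
proof -
  define E where "E = dual_const H F G Lg (real K) (1 / \<sigma>)"
  define B where "B = step_const H G Lg"
  have z': "z \<in> prob_simplex d" and gz: "\<And>k. k \<in> {1..K} \<Longrightarrow> g k z \<le> 0"
    using z by (auto simp: feasible_def)
  have "0 < \<sigma>"
    using slater by (simp add: slater_def)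
  then have E: "0 \<le> E" and B: "0 \<le> B"
    using constants_nonneg(1-4) by (auto simp: E_def B_def dual_const_def window_const_def step_const_def)
  have "regret T f x z = (\<Sum>t = 1..T. f t (x t) - f t z)"
    by (simp add: regret_def sum_subtractf)
  also have "\<dots> \<le> (\<Sum>t = 1..T. dot d (df t (x t)) (x t - z))"
  proof (rule sum_mono)
    fix t assume "t \<in> {1..T}"
    then show "f t (x t) - f t z \<le> dot d (df t (x t)) (x t - z)"
      using convex_diff_above_tangent[OF f x_in_prob_simplex z', of t t] by (simp add: dot_diff_right)
  qed
  also have "\<dots> \<le> \<gamma>\<^sup>2 / 2 + \<alpha> T * M"
  proof -
    have "(\<Sum>t = 1..T. \<Sum>k = 1..K. weight k t * g k z) \<le> 0"
      using weight_nonneg gz by (intro sum_nonpos mult_nonneg_nonpos) auto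
    then have "\<gamma> * (\<Sum>t = 1..T. \<Sum>k = 1..K. weight k t * g k z) \<le> 0"
      using \<gamma> by (simp add: mult_le_0_iff)
    moreover have "\<alpha> T * (M - 2) \<le> \<alpha> T * M"
      using \<alpha>_pos(2)[of T] T_pos by (intro mult_left_mono) auto
    ultimately show ?thesis
      using tuned_window_inequality[of 1 T z] T_pos z' potential_1 potential_Suc_nonneg[of T]
      by simp
  qed
  also have "\<dots> \<le> \<gamma>\<^sup>2 * M\<^sup>2 + \<gamma>\<^sup>2 * ((B + 3 * Lg * (real K * E)) * M\<^sup>2)"
  proof (rule add_mono)
    have "1 \<le> M\<^sup>2"
      using M_ge_1 by (rule one_le_power)
    then show "\<gamma>\<^sup>2 / 2 \<le> \<gamma>\<^sup>2 * M\<^sup>2"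
      using mult_left_mono[of 1 "M\<^sup>2" "\<gamma>\<^sup>2"] zero_le_power2[of \<gamma>] by linarith
    have "\<alpha> T \<le> \<gamma>\<^sup>2 * (B + 3 * Lg * (real K * (E * M)))"
      unfolding B_def E_def using E M_ge_1 dual_bound[OF slater]
      by (intro \<alpha>_le) (auto simp: E_def)
    also have "\<dots> \<le> \<gamma>\<^sup>2 * ((B + 3 * Lg * (real K * E)) * M)"
      using B M_ge_1 mult_left_mono[of 1 M B] by (intro mult_left_mono) (auto simp: algebra_simps)
    finally have "\<alpha> T * M \<le> \<gamma>\<^sup>2 * ((B + 3 * Lg * (real K * E)) * M) * M"
      using M_ge_1 by (intro mult_right_mono) auto
    then show "\<alpha> T * M \<le> \<gamma>\<^sup>2 * ((B + 3 * Lg * (real K * E)) * M\<^sup>2)"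
      by (simp add: power2_eq_square mult_ac)
  qed
  also have "\<dots> = \<gamma>\<^sup>2 * (regret_const H F G Lg (real K) (1 / \<sigma>) * M\<^sup>2)"
    by (simp add: regret_const_def B_def E_def algebra_simps)
  finally show ?thesis .
qed

end

section \<open>The regret for the prescribed parameters\<close>

lemma real_polynomial_regret_const:
  "real_polynomial_function (\<lambda>(H, F, G, Lg, K, s). 98 * regret_const H F G Lg K s)"
proof -
  have proj: "real_polynomial_function (\<lambda>q. fst (q :: real \<times> real \<times> real \<times> real \<times> real \<times> real))"
    "real_polynomial_function (\<lambda>q. fst (snd (q :: real \<times> real \<times> real \<times> real \<times> real \<times> real)))"
    "real_polynomial_function (\<lambda>q. fst (snd (snd (q :: real \<times> real \<times> real \<times> real \<times> real \<times> real))))"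
    "real_polynomial_function (\<lambda>q. fst (snd (snd (snd (q :: real \<times> real \<times> real \<times> real \<times> real \<times> real)))))"
    "real_polynomial_function (\<lambda>q. fst (snd (snd (snd (snd (q :: real \<times> real \<times> real \<times> real \<times> real \<times> real))))))"
    "real_polynomial_function (\<lambda>q. snd (snd (snd (snd (snd (q :: real \<times> real \<times> real \<times> real \<times> real \<times> real))))))"
    by (intro real_polynomial_function.intros(1) bounded_linear_fst_comp bounded_linear_snd_comp
        bounded_linear_fst bounded_linear_snd)+
  show ?thesis
    unfolding case_prod_beta regret_const_def dual_const_def window_const_def step_const_def
    by (intro real_polynomial_function.intros(2-4) real_polynomial_function_power proj)
qed

text \<open>
  The gradients are bounded, hence the suprema that define the variation are suprema of sets that
  are bounded above, and they dominate the values at the decisions.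
\<close>
lemma gradient_variation_le_V_inf:
  assumes d: "1 \<le> d"
    and bound: "\<And>t u. u \<in> prob_simplex d \<Longrightarrow> norm_inf d (df t u) \<le> F"
    and x: "\<And>t. t \<in> {1..T} \<Longrightarrow> x t \<in> prob_simplex d"
  shows "(\<Sum>t = 1..T. (norm_inf d (df t (x t) - df (t - 1) (x t)))\<^sup>2) \<le> V_inf d T df"
  unfolding V_inf_def
proof (rule sum_mono)
  fix t assume "t \<in> {1..T}"
  have "(norm_inf d (df t u - df (t - 1) u))\<^sup>2 \<le> (F + F)\<^sup>2" if "u \<in> prob_simplex d" for u
    using norm_inf_triangle(2)[OF d, of "df t u" "df (t - 1) u"] bound[OF that, of t] bound[OF that, of "t - 1"]
    by (intro power_mono norm_inf_nonneg d) auto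
  then have "bdd_above ((\<lambda>u. (norm_inf d (df t u - df (t - 1) u))\<^sup>2) ` prob_simplex d)"
    by (intro bdd_aboveI2)
  then show "(norm_inf d (df t (x t) - df (t - 1) (x t)))\<^sup>2
      \<le> (SUP u\<in>prob_simplex d. (norm_inf d (df t u - df (t - 1) u))\<^sup>2)"
    by (rule cSUP_upper2[OF _ x[OF \<open>t \<in> {1..T}\<close>] order_refl])
qed

theorem theorem6p1:
  "\<exists>p :: real \<times> real \<times> real \<times> real \<times> real \<times> real \<Rightarrow> real. real_polynomial_function p \<and>
    (\<forall>(d :: nat) (T :: nat) (K :: nat)
      (f :: nat \<Rightarrow> rvec \<Rightarrow> real) (df :: nat \<Rightarrow> rvec \<Rightarrow> rvec)
      (g :: nat \<Rightarrow> rvec \<Rightarrow> real) (dg :: nat \<Rightarrow> rvec \<Rightarrow> rvec)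
      (F :: real) (Lf :: real) (G :: real) (Hk :: nat \<Rightarrow> real) (H :: real) (Lg :: real) (\<sigma> :: real)
      (V :: real) (\<eta> :: real) (\<gamma> :: real) (\<nu> :: real) (\<alpha> :: nat \<Rightarrow> real)
      (x :: nat \<Rightarrow> rvec) (xt :: nat \<Rightarrow> rvec) (Q :: nat \<Rightarrow> nat \<Rightarrow> real) (xstar :: rvec).
      1 \<le> d \<longrightarrow> 2 < T \<longrightarrow>
      (\<forall>t. convex_diff d (f t) (df t)) \<longrightarrow>
      (\<forall>k\<in>{1..K}. convex_diff d (g k) (dg k)) \<longrightarrow>
      bounded_smooth d K df g dg F Lf G Hk Lg \<longrightarrow>
      H = (\<Sum>k = 1..K. Hk k) \<longrightarrow>
      slater d K g \<sigma> \<longrightarrow>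
      V = V_inf d T df \<longrightarrow>
      \<eta> = (V + Lf\<^sup>2 + 1) powr (- 1 / 2) \<longrightarrow>
      \<gamma> = (V + Lf\<^sup>2 + 1) powr (1 / 4) \<longrightarrow>
      \<nu> = 1 / real T \<longrightarrow>
      step_params K T \<eta> \<gamma> Lf G H Lg Q \<alpha> \<longrightarrow>
      mirror_prox_run d K T df g dg \<gamma> \<nu> \<alpha> x xt Q \<longrightarrow>
      is_arg_min (\<lambda>z. \<Sum>t = 1..T. f t z) (\<lambda>z. z \<in> feasible d K g) xstar \<longrightarrow>
      regret T f x xstar
        \<le> p (H, F, G, Lg, real K, 1 / \<sigma>) * (ln (real T * real d))\<^sup>2 * max 1 (max (sqrt V) Lf))"
proof (intro exI[of _ "\<lambda>(H, F, G, Lg, K, s). 98 * regret_const H F G Lg K s"] conjI allI impI)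
  show "real_polynomial_function (\<lambda>(H, F, G, Lg, K, s). 98 * regret_const H F G Lg K s)"
    by (rule real_polynomial_regret_const)
next
  fix d T K :: nat
    and f :: "nat \<Rightarrow> rvec \<Rightarrow> real" and df :: "nat \<Rightarrow> rvec \<Rightarrow> rvec"
    and g :: "nat \<Rightarrow> rvec \<Rightarrow> real" and dg :: "nat \<Rightarrow> rvec \<Rightarrow> rvec"
    and F Lf G :: real and Hk :: "nat \<Rightarrow> real" and H Lg \<sigma> V \<eta> \<gamma> \<nu> :: real and \<alpha> :: "nat \<Rightarrow> real"
    and x xt :: "nat \<Rightarrow> rvec" and Q :: "nat \<Rightarrow> nat \<Rightarrow> real" and xstar :: rvec
  assume d: "1 \<le> d" and T: "2 < T"
    and f: "\<forall>t. convex_diff d (f t) (df t)"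
    and g: "\<forall>k\<in>{1..K}. convex_diff d (g k) (dg k)"
    and bounded_smooth: "bounded_smooth d K df g dg F Lf G Hk Lg"
    and H: "H = (\<Sum>k = 1..K. Hk k)"
    and slater: "slater d K g \<sigma>"
    and V: "V = V_inf d T df"
    and \<eta>: "\<eta> = (V + Lf\<^sup>2 + 1) powr (- 1 / 2)"
    and \<gamma>: "\<gamma> = (V + Lf\<^sup>2 + 1) powr (1 / 4)"
    and \<nu>': "\<nu> = 1 / real T"
    and steps: "step_params K T \<eta> \<gamma> Lf G H Lg Q \<alpha>"
    and run: "mirror_prox_run d K T df g dg \<gamma> \<nu> \<alpha> x xt Q"
    and xstar: "is_arg_min (\<lambda>z. \<Sum>t = 1..T. f t z) (\<lambda>z. z \<in> feasible d K g) xstar"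
  define \<phi> where "\<phi> = V + Lf\<^sup>2 + 1"
  define M where "M = ln (real d / \<nu>) + 6"
  have x: "x t \<in> prob_simplex d" if "t \<in> {1..T}" for t
    using run that by (auto simp: mirror_prox_run_def Let_def is_arg_min_def)
  have variation: "(\<Sum>t = 1..T. (norm_inf d (df t (x t) - df (t - 1) (x t)))\<^sup>2) \<le> V"
    unfolding V using bounded_smooth x
    by (intro gradient_variation_le_V_inf[OF d]) (auto simp: bounded_smooth_def)
  have "0 \<le> (\<Sum>t = 1..T. (norm_inf d (df t (x t) - df (t - 1) (x t)))\<^sup>2)"
    by (intro sum_nonneg) simp
  then have V_nonneg: "0 \<le> V"
    using variation by linarith
  then have \<phi>_ge: "1 \<le> \<phi>" "V \<le> \<phi>" "Lf\<^sup>2 \<le> \<phi>"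
    by (auto simp: \<phi>_def)
  have \<gamma>2: "\<gamma>\<^sup>2 = sqrt \<phi>"
    using \<phi>_ge(1) by (simp add: \<gamma> \<phi>_def[symmetric] powr_half_sqrt[symmetric] powr_power)
  have \<eta>': "\<eta> = 1 / sqrt \<phi>"
    using \<phi>_ge(1) by (simp add: \<eta> \<phi>_def[symmetric] powr_half_sqrt[symmetric] powr_minus_divide)
  have sqrt_\<phi>: "1 \<le> sqrt \<phi>" "\<phi> = sqrt \<phi> * sqrt \<phi>"
    using \<phi>_ge(1) by auto
  have scaled: "\<eta> * a \<le> \<gamma>\<^sup>2" if "a \<le> \<phi>" for a
    using that sqrt_\<phi> by (simp add: \<eta>' \<gamma>2 divide_le_eq)
  interpret mirror_prox d T K f df g dg F Lf G Hk H Lg \<eta> \<gamma> \<nu> \<alpha> x xt Q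
  proof
    show "0 < \<eta>" "0 < \<gamma>"
      using \<phi>_ge(1) by (auto simp: \<eta> \<gamma> \<phi>_def[symmetric])
    show "0 < \<nu>" "\<nu> \<le> 1 / 2"
      using T by (auto simp: \<nu>')
  qed (use d f g bounded_smooth H steps run in auto)
  interpret tuned_mirror_prox d T K f df g dg F Lf G Hk H Lg \<eta> \<gamma> \<nu> \<alpha> x xt Q M
  proof
    show "\<eta> * \<gamma>\<^sup>2 = 1" "1 \<le> \<gamma>\<^sup>2"
      using sqrt_\<phi>(1) by (auto simp: \<eta>' \<gamma>2)
    show "\<eta> * Lf\<^sup>2 \<le> \<gamma>\<^sup>2"
      by (intro scaled \<phi>_ge)
    show "\<eta> * (\<Sum>t = 1..T. (gradient_variation t)\<^sup>2) \<le> \<gamma>\<^sup>2"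
      using variation \<phi>_ge(2) by (intro scaled) (simp add: gradient_variation_def)
  qed (use T \<nu>' M_def in auto)
  define m where "m = max 1 (max (sqrt V) Lf)"
  have m: "1 \<le> m" "sqrt V \<le> m" "Lf \<le> m"
    by (auto simp: m_def)
  have "\<phi> \<le> (2 * m)\<^sup>2"
  proof -
    have "V \<le> m\<^sup>2"
      using m(2) power_mono[of "sqrt V" m 2] V_nonneg by simp
    moreover have "Lf\<^sup>2 \<le> m\<^sup>2"
      using m(3) constants_nonneg(2) by (intro power_mono)
    moreover have "1 \<le> m\<^sup>2"
      using m(1) by (rule one_le_power)
    ultimately show ?thesis by (simp add: \<phi>_def power_mult_distrib)
  qed
  then have \<gamma>2_le: "\<gamma>\<^sup>2 \<le> 2 * m"
    using m(1) by (simp add: \<gamma>2 real_le_lsqrt)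
  define l where "l = ln (real T * real d)"
  have "3 * 1 \<le> real T * real d"
    using T d by (intro mult_mono) auto
  moreover have "exp 1 \<le> (3 :: real)"
    by (rule exp_le)
  ultimately have l: "1 \<le> l"
    using ln_ge_iff[of "real T * real d" 1] by (simp add: l_def)
  have "M = l + 6"
    by (simp add: M_def l_def \<nu>' mult.commute)
  then have "M \<le> 7 * l" "0 \<le> M"
    using l by auto
  then have M2_le: "M\<^sup>2 \<le> 49 * l\<^sup>2"
    using power_mono[of M "7 * l" 2] by (simp add: power_mult_distrib)
  have "0 < \<sigma>"
    using slater by (simp add: slater_def)
  moreover have "0 \<le> H"
    unfolding H by (intro sum_nonneg constants_nonneg(5))
  ultimately have const: "0 \<le> regret_const H F G Lg (real K) (1 / \<sigma>)"
    using constants_nonneg(1-4)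
    by (auto simp: regret_const_def dual_const_def window_const_def step_const_def)
  \<comment> \<open>The coefficient \<open>98\<close> is \<open>2 * 7\<^sup>2\<close>.\<close>
  have "regret T f x xstar \<le> \<gamma>\<^sup>2 * (regret_const H F G Lg (real K) (1 / \<sigma>) * M\<^sup>2)"
    using xstar by (intro regret_bound slater) (simp add: is_arg_min_def)
  also have "\<dots> \<le> (2 * m) * (regret_const H F G Lg (real K) (1 / \<sigma>) * (49 * l\<^sup>2))"
    using const m by (intro mult_mono \<gamma>2_le M2_le order_refl mult_nonneg_nonneg) auto
  finally show "regret T f x xstar
      \<le> (case (H, F, G, Lg, real K, 1 / \<sigma>) of (H, F, G, Lg, K, s) \<Rightarrow> 98 * regret_const H F G Lg K s)
        * (ln (real T * real d))\<^sup>2 * max 1 (max (sqrt V) Lf)"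
    by (simp add: m_def l_def mult_ac)
qed

end
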